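(* Let $A$ be a symmetric positive definite $n\times n$ matrix with integer entries, let $u\in\mathbb{C}^n$, let $\tau$ be in the upper half-plane, and let $\epsilon\in\mathbb{C}^n$ with $\epsilon_j\notin i\mathbb{R}$ for $j=1,\dots,n$. Then $$P_\epsilon\left(\frac u\tau,-\frac1\tau\right)=h_\epsilon(u,\tau)+e^{\frac{\pi i}{\tau}(u,Au)}(2i)^{-n}\sqrt{\frac{(-i\tau)^n}{\det A}}\;I,$$ where $$I=\sum_{\emptyset\neq v\subseteq\{1,\dots,n\}}i^{|v|}\left(\prod_{j\in v}\bigl(1+\mathrm{sgn}(\mathrm{Re}(\epsilon_j))\bigr)\right)I^{(v)},$$ $$I^{(v)}=\int_{\mathbb{R}^{n-|v|}}\theta_{B^{(v)},\epsilon^{(v)}}\left(x^{(v)}(w^{(v)})\tau-u^{(v)};\tau\right)\frac{q^{\frac12(w^{(v)},A^{-1}w^{(v)})}e^{-2\pi i(u,w^{(v)})}}{\prod_{j\notin v}\sin(\pi(w^{(v)}_j-i\epsilon_j))}\,d^{n-|v|}w^{(v)} .$$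
   Context: Here $(x,y)=\sum_j x_jy_j$ is the standard $\mathbb{C}$-bilinear form, $e_1,\dots,e_n$ is the standard basis of $\mathbb{C}^n$, $q=e^{2\pi i\tau}$ (and $q^{a}=e^{2\pi i\tau a}$), and $\sqrt{(-i\tau)^n/\det A}$ means $(\sqrt{-i\tau})^n/\sqrt{\det A}$ with principal branch of the square root. The regularized partial theta function is $$P_\epsilon(u,\tau)=\sum_{k\in(\mathbb{Z}_{\ge0}+\frac12)^n}q^{\frac12(k,Ak)}e^{2\pi i(k,Au)}e^{2\pi(k,\epsilon)},$$ and $$h_\epsilon(u,\tau)=e^{\frac{\pi i}{\tau}(u,Au)}(2i)^{-n}\sqrt{\frac{(-i\tau)^n}{\det A}}\int_{\mathbb{R}^n}\frac{q^{\frac12(w,A^{-1}w)}e^{-2\pi i(u,w)}}{\prod_{j=1}^n\sin(\pi(w_j-i\epsilon_j))}\,d^nw .$$ For a symmetric $r\times r$ matrix $B$ with rational entries and $u,\epsilon\in\mathbb{C}^r$, with $s=e_1+\dots+e_r$, set $$\theta_{B,\epsilon}(u;\tau)=\sum_{m\in\mathbb{Z}^r+i\epsilon}(-1)^{(m-i\epsilon,s)}q^{\frac12(m,Bm)}e^{2\pi i(u,m)} .$$ For a nonempty subset $v\subseteq\{1,\dots,n\}$ and $w\in\mathbb{R}^n$: - $w^{(v)}=w-\sum_{i\in v}(w,e_i)e_i$ (the coordinates in $v$ are set to zero); the space of such vectors is identified with $\mathbb{R}^{n-|v|}$ and carries Lebesgue measure $d^{n-|v|}w^{(v)}$ in the coordinates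 $w_j$, $j\notin v$; if $v=\{1,\dots,n\}$ the integral is just the value of the integrand at $w^{(v)}=0$, with empty product equal to $1$; - $B^{(v)}=\bigl((e_a,A^{-1}e_b)\bigr)_{a,b\in v}$; - $u^{(v)}=\sum_{i\in v}(u,e_i)e_i$, $\epsilon^{(v)}=\sum_{i\in v}(\epsilon,e_i)e_i$, $x^{(v)}(w^{(v)})=\sum_{i\in v}(e_i,A^{-1}w^{(v)})e_i$, each regarded as a vector in $\mathbb{C}^{|v|}$ indexed by $v$.
   Formalization: The printed identity has wrong signs (it already fails for n=1, Re ε<0, u=0, τ=i, ε real, where it would force P=0); the formal version multiplies h_ε by (-1)^n and the v-summand of I by (-1)^{n-|v|}, one factor -1 per sine in the denominator. *)

theory Defs
  imports "HOL-Analysis.Analysis"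
begin

text \<open>
  The dimension \<open>n\<close> is \<open>CARD('n)\<close>. All infinite sums are unconditional sums (\<open>infsum\<close>) and all
  integrals are Lebesgue integrals.
\<close>

definition bilin :: "complex^'n \<Rightarrow> complex^'n \<Rightarrow> complex" where
  "bilin x y = (\<Sum>j\<in>UNIV. x $ j * y $ j)"

definition cvec :: "real^'n \<Rightarrow> complex^'n" where
  "cvec x = (\<chi> j. complex_of_real (x $ j))"

definition cmat :: "real^'n^'m \<Rightarrow> complex^'n^'m" where
  "cmat M = (\<chi> i j. complex_of_real (M $ i $ j))"

definition pos_def :: "real^'n^'n \<Rightarrow> bool" where
  "pos_def A \<longleftrightarrow> (\<forall>x. x \<noteq> 0 \<longrightarrow> x \<bullet> (A *v x) > 0)"

text \<open>\<open>qpow \<tau> a\<close> is \<open>q\<close> to the power \<open>a\<close>, where \<open>q = e\<close> to the power \<open>2 \<pi> i \<tau>\<close>.\<close>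

definition qpow :: "complex \<Rightarrow> complex \<Rightarrow> complex" where
  "qpow \<tau> a = exp (2 * of_real pi * \<i> * \<tau> * a)"

definition half_orthant :: "(complex^'n) set" where
  "half_orthant = {k. \<forall>j. \<exists>l::nat. k $ j = of_nat l + 1/2}"

definition partial_theta ::
    "real^'n^'n \<Rightarrow> complex^'n \<Rightarrow> complex^'n \<Rightarrow> complex \<Rightarrow> complex" where
  "partial_theta A \<epsilon> u \<tau> =
     (\<Sum>\<^sub>\<infinity>k\<in>half_orthant.
        qpow \<tau> (1/2 * bilin k (cmat A *v k))
        * exp (2 * of_real pi * \<i> * bilin k (cmat A *v u))
        * exp (2 * of_real pi * bilin k \<epsilon>))"

definition prefactor :: "real^'n^'n \<Rightarrow> complex^'n \<Rightarrow> complex \<Rightarrow> complex" where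
  "prefactor A u \<tau> =
     exp (of_real pi * \<i> / \<tau> * bilin u (cmat A *v u))
     * inverse ((2 * \<i>) ^ CARD('n))
     * (csqrt (- \<i> * \<tau>) ^ CARD('n) / csqrt (of_real (det A)))"

definition h_eps ::
    "real^'n^'n \<Rightarrow> complex^'n \<Rightarrow> complex^'n \<Rightarrow> complex \<Rightarrow> complex" where
  "h_eps A \<epsilon> u \<tau> =
     prefactor A u \<tau> *
     (LINT w|(lborel :: (real^'n) measure).
        qpow \<tau> (1/2 * bilin (cvec w) (cmat (matrix_inv A) *v cvec w))
        * exp (- 2 * of_real pi * \<i> * bilin u (cvec w))
        / (\<Prod>j\<in>UNIV. sin (of_real pi * (of_real (w $ j) - \<i> * \<epsilon> $ j))))"

text \<open>
  Sign pitfall. For \<open>z = w - i \<epsilon>\<close> with \<open>Re \<epsilon> < 0\<close> the geometric series gives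
  \<open>1 / sin (\<pi> z) = - 2 i (\<Sum>k. exp (2 \<pi> i k z))\<close> (\<open>k = 1/2, 3/2, \<dots>\<close>), that is, a factor \<open>-1\<close> for each
  sine relative to the normalisation \<open>1 / (2 i)\<close> in \<open>prefactor\<close>. If all \<open>Re (\<epsilon> $ j)\<close> are negative,
  termwise Gaussian integration therefore yields
  \<open>partial_theta A \<epsilon> (u / \<tau>) (- 1 / \<tau>) = (- 1) ^ n * h_eps A \<epsilon> u \<tau>\<close>. So a transformation formula
  in terms of these functions needs the factor \<open>(- 1) ^ (n - |v|)\<close> on an integral with \<open>n - |v|\<close>
  sines in the denominator. The source prints the formula without these factors; in that form it
  fails, for instance whenever \<open>n\<close> is odd, all \<open>Re (\<epsilon> $ j) < 0\<close> and the left-hand side is nonzero.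
\<close>

text \<open>
  Matrices and vectors of size \<open>r\<close> are indexed by a finite set \<open>v\<close> with \<open>r\<close> elements; only the
  entries of \<open>B\<close>, \<open>\<epsilon>\<close>, \<open>u\<close> with indices in \<open>v\<close> matter. The points \<open>m\<close> of the shifted lattice
  are parametrised by the integer vectors \<open>l = m - i \<epsilon>\<close>.
\<close>

definition theta ::
    "'a set \<Rightarrow> ('a \<Rightarrow> 'a \<Rightarrow> real) \<Rightarrow> ('a \<Rightarrow> complex) \<Rightarrow> ('a \<Rightarrow> complex) \<Rightarrow> complex \<Rightarrow> complex" where
  "theta v B \<epsilon> u \<tau> =
     (\<Sum>\<^sub>\<infinity>l\<in>(\<Pi>\<^sub>E j\<in>v. (UNIV :: int set)).
        let m = (\<lambda>j. of_int (l j) + \<i> * \<epsilon> j) in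
          (- 1) powi (\<Sum>j\<in>v. l j)
          * qpow \<tau> (1/2 * (\<Sum>a\<in>v. \<Sum>b\<in>v. m a * of_real (B a b) * m b))
          * exp (2 * of_real pi * \<i> * (\<Sum>j\<in>v. u j * m j)))"

text \<open>
  The coordinates \<open>w j\<close>, \<open>j \<notin> v\<close>, range over the product measure space indexed by \<open>- v\<close>, and
  \<open>zero_on v w\<close> is the vector with these coordinates and zeros in \<open>v\<close>. For \<open>v = UNIV\<close> that
  measure space is a single point of mass one, so the integral is the value at the zero vector.
\<close>

definition zero_on :: "'n set \<Rightarrow> ('n \<Rightarrow> real) \<Rightarrow> real^'n" where
  "zero_on v w = (\<chi> j. if j \<in> v then 0 else w j)"

definition I_sub ::
    "real^'n^'n \<Rightarrow> complex^'n \<Rightarrow> complex^'n \<Rightarrow> complex \<Rightarrow> 'n set \<Rightarrow> complex" where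
  "I_sub A \<epsilon> u \<tau> v =
     (LINT w|(\<Pi>\<^sub>M j\<in>- v. (lborel :: real measure)).
        (let wv = cvec (zero_on v w); Ainv = matrix_inv A in
          theta v (\<lambda>a b. Ainv $ a $ b) (\<lambda>j. \<epsilon> $ j)
            (\<lambda>j. (cmat Ainv *v wv) $ j * \<tau> - u $ j) \<tau>
          * (qpow \<tau> (1/2 * bilin wv (cmat Ainv *v wv))
             * exp (- 2 * of_real pi * \<i> * bilin u wv)
             / (\<Prod>j\<in>- v. sin (of_real pi * (wv $ j - \<i> * \<epsilon> $ j))))))"

end

theory Submission
  imports Defs "HOL-Complex_Analysis.Complex_Analysis" "HOL-Probability.Distributions"
begin

text \<open>
  Write \<open>B\<close> for the inverse of \<open>A\<close>, \<open>F z = exp (\<pi> i \<tau> (z, B z) - 2 \<pi> i (u, z))\<close> and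
  \<open>K z = - 1 / (2 i sin (\<pi> z))\<close>; the latter is the sum of \<open>exp (2 \<pi> i k z)\<close> over
  \<open>k = 1/2, 3/2, \<dots>\<close> when \<open>Im z > 0\<close>.

  After \<open>\<tau> \<mapsto> - 1 / \<tau>\<close> every Gaussian term of the partial theta series is itself a Gaussian
  integral: up to the common factor in \<open>prefactor\<close>, the term with index \<open>k\<close> is the integral of
  \<open>F z\<close> against the product of the \<open>exp (2 \<pi> i k\<^sub>j (z\<^sub>j - i \<epsilon>\<^sub>j))\<close>, and the integral may be taken over
  any translate of \<open>\<real>\<^sup>n\<close> in \<open>\<complex>\<^sup>n\<close> (\<open>gauss_integral\<close>). In a coordinate with \<open>Re \<epsilon>\<^sub>j > 0\<close> the geometric
  series diverges on the real line. It converges on a line raised above the height \<open>Re \<epsilon>\<^sub>j\<close>, and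
  this is where \<open>z\<^sub>j\<close> is put; for \<open>Re \<epsilon>\<^sub>j < 0\<close> the real line itself serves. Now sum and integral can be exchanged, and the whole series becomes one
  integral of \<open>F z\<close> against the product of the \<open>K (z\<^sub>j - i \<epsilon>\<^sub>j)\<close> over raised lines
  (\<open>partial_theta_eq_multi_integral\<close>).

  It remains to lower the raised lines to the real axis, one coordinate at a time. Each
  move crosses the simple poles at \<open>l + i \<epsilon>\<^sub>j\<close>, \<open>l \<in> \<int>\<close>, where the residue theorem contributes the sum
  over \<open>l\<close> of \<open>(- 1)\<^sup>l\<close> times the value at \<open>z\<^sub>j = l + i \<epsilon>\<^sub>j\<close> (\<open>residue_shift\<close>, \<open>contour_step\<close>). So
  \<open>z\<^sub>j\<close> on a raised line is replaced by \<open>z\<^sub>j\<close> on the real axis plus \<open>z\<^sub>j\<close> in a shifted lattice, and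
  multiplying this out over all coordinates gives one summand for each set \<open>v\<close> of coordinates that sit
  in the lattice (\<open>multi_integral_expand\<close>). A lattice sum is an integral for a counting measure, hence
  each hybrid of sums and integrals is an integral over a product measure, absolutely convergent by
  the Gaussian decay of \<open>F\<close>, and Fubini's theorem justifies each move. For fixed \<open>v\<close> the sum over
  the lattice coordinates is the theta function in the integrand of \<open>I_sub\<close>
  (\<open>multi_integral_subset\<close>).
\<close>

section \<open>Decay and summability of Gaussians\<close>

lemma gaussian_integrable:
  fixes \<delta> r :: real
  assumes "\<delta> > 0"
  shows "integrable lborel (\<lambda>x. exp (- \<delta> * (x + r)\<^sup>2))"
proof -
  define \<sigma> where "\<sigma> = sqrt (1 / (2 * \<delta>))"
  have "\<sigma> > 0" "\<sigma>\<^sup>2 = 1 / (2*\<delta>)" using assms by (auto simp: \<sigma>_def)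
  have "integrable lborel (\<lambda>x. sqrt (2 * pi * \<sigma>\<^sup>2) * normal_density (-r) \<sigma> x)"
    by (intro integrable_mult_right integrable_normal_density) (use \<open>\<sigma> > 0\<close> in auto)
  also have "(\<lambda>x. sqrt (2 * pi * \<sigma>\<^sup>2) * normal_density (-r) \<sigma> x) = (\<lambda>x. exp (- \<delta> * (x + r)\<^sup>2))"
    using assms \<open>\<sigma> > 0\<close> unfolding normal_density_def \<open>\<sigma>\<^sup>2 = _\<close> by (auto simp: field_simps)
  finally show ?thesis .
qed

text \<open>
  Used for Lebesgue measure on growing intervals and for counting measure on \<open>\<int>\<close>: it is the passage
  from finite rectangles, with finitely many residues inside, to whole lines.
\<close>
lemma integral_exhaustion:
  fixes g :: "'a \<Rightarrow> 'b :: {banach, second_countable_topology}"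
  assumes "integrable M g" and [measurable]: "\<And>n::nat. A n \<in> sets M"
    and "\<And>x. x \<in> space M \<Longrightarrow> eventually (\<lambda>n. x \<in> A n) sequentially"
  shows "(\<lambda>n. LINT x:A n|M. g x) \<longlonglongrightarrow> (LINT x|M. g x)"
  unfolding set_lebesgue_integral_def
proof (rule integral_dominated_convergence[where w="\<lambda>x. norm (g x)"])
  show "g \<in> borel_measurable M" using assms(1) by auto
  then show "(\<lambda>x. indicat_real (A i) x *\<^sub>R g x) \<in> borel_measurable M" for i by measurable
  show "integrable M (\<lambda>x. norm (g x))" using assms by auto
  show "AE x in M. (\<lambda>i. indicat_real (A i) x *\<^sub>R g x) \<longlonglongrightarrow> g x"
  proof (rule AE_I2)
    fix x assume "x \<in> space M"
    then have "eventually (\<lambda>n. indicat_real (A n) x *\<^sub>R g x = g x) sequentially"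
      using assms(3)[of x] by (auto elim!: eventually_mono)
    then show "(\<lambda>i. indicat_real (A i) x *\<^sub>R g x) \<longlonglongrightarrow> g x"
      by (rule tendsto_eventually)
  qed
qed (auto simp: indicator_def)

lemma integrable_count_space_image:
  fixes f :: "'b \<Rightarrow> 'c :: {banach, second_countable_topology}"
  assumes "inj_on h X"
  shows "integrable (count_space (h ` X)) f \<longleftrightarrow> integrable (count_space X) (f \<circ> h)"
  using abs_summable_on_reindex_iff[OF assms, of f] by (simp add: abs_summable_on_def o_def)

lemma gaussian_summable_Ints:
  fixes \<delta> r :: real
  assumes "\<delta> > 0"
  shows "integrable (count_space \<int>) (\<lambda>x. exp (- \<delta> * (x + r)\<^sup>2))"
proof -
  have *: "integrable (count_space (range real)) (\<lambda>x. exp (- \<delta> * (x + r)\<^sup>2))" for r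
  proof -
    have "summable (\<lambda>n::nat. exp (- \<delta> * (real n + r)\<^sup>2))"
    proof (rule summable_comparison_test_ev)
      \<comment> \<open>Comparison with the geometric series of ratio \<open>exp (- 1)\<close>.\<close>
      have "((\<lambda>n::nat. exp (- \<delta> * (real n + r)\<^sup>2) * exp (real n)) \<longlongrightarrow> 0) sequentially"
        using assms by real_asymp
      then have "eventually (\<lambda>n::nat. exp (- \<delta> * (real n + r)\<^sup>2) * exp (real n) < 1) sequentially"
        by (rule order_tendstoD) simp
      then show "\<forall>\<^sub>F n in sequentially. norm (exp (- \<delta> * (real n + r)\<^sup>2)) \<le> exp (-1) ^ n"
        by eventually_elim (auto simp: exp_minus field_simps simp flip: exp_of_nat_mult)
      show "summable (\<lambda>n. exp (-1::real) ^ n)" by (rule summable_geometric) auto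
    qed
    then show ?thesis
      by (subst integrable_count_space_image) (auto simp: integrable_count_space_nat_iff)
  qed
  have "integrable (count_space (uminus ` range real)) (\<lambda>x. exp (- \<delta> * (x + r)\<^sup>2))"
    using *[of "-r"] by (subst integrable_count_space_image) (auto simp: o_def power2_commute)
  with *[of r] have "integrable (count_space (range real \<union> uminus ` range real)) (\<lambda>x. exp (- \<delta> * (x + r)\<^sup>2))"
    using abs_summable_on_union unfolding abs_summable_on_def by blast
  also have "range real \<union> uminus ` range real = \<int>"
  proof -
    have "x \<in> range real \<union> uminus ` range real" if "x \<in> \<int>" for x
      using that by (elim Ints_cases, rename_tac z, case_tac z rule: int_cases2) auto
    then show ?thesis by auto
  qed
  finally show ?thesis .
qed

section \<open>The kernel and its residues\<close>

text \<open>
  The sum of the geometric series \<open>exp (2 \<pi> i k z)\<close>, \<open>k = 1/2, 3/2, \<dots>\<close>, which converges for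
  \<open>Im z > 0\<close>, continued to the whole plane.
\<close>
definition kern :: "complex \<Rightarrow> complex" where
  "kern z = - 1 / (2 * \<i> * sin (of_real pi * z))"

lemma sin_pi_eq_0_iff_Ints:
  "sin (of_real pi * z) = 0 \<longleftrightarrow> z \<in> \<int>" for z :: complex
  by (subst sin_eq_0) (auto elim!: Ints_cases simp: field_simps)

lemma norm_sin_ge:
  "norm (sin z) \<ge> \<bar>sinh (Im z)\<bar>"
proof -
  have "(norm (sin z))\<^sup>2 = (sin (Re z))\<^sup>2 + (sinh (Im z))\<^sup>2"
    unfolding norm_sin_squared sinh_field_def cos_double_sin[of "Re z"]
    by (simp add: power2_eq_square field_simps flip: exp_add)
  then have "\<bar>sinh (Im z)\<bar>\<^sup>2 \<le> (norm (sin z))\<^sup>2" by simp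
  then show ?thesis by (rule power2_le_imp_le) auto
qed

lemma norm_kern_le:
  assumes "Im z \<noteq> 0"
  shows "norm (kern z) \<le> 1 / (2 * \<bar>sinh (pi * Im z)\<bar>)"
proof -
  have "\<bar>sinh (pi * Im z)\<bar> > 0" using assms by simp
  moreover have "\<bar>sinh (pi * Im z)\<bar> \<le> norm (sin (of_real pi * z))"
    using norm_sin_ge[of "of_real pi * z"] by simp
  ultimately show ?thesis
    by (simp add: kern_def norm_divide norm_mult frac_le)
qed

lemma kern_geometric:
  assumes "Im z > 0"
  shows "(\<lambda>l::nat. exp (2 * of_real pi * \<i> * (of_nat l + 1/2) * z)) sums kern z"
proof -
  define x where "x = exp (2 * of_real pi * \<i> * z)"
  have "norm x < 1" using assms by (simp add: x_def)
  then have "(\<lambda>l. exp (of_real pi * \<i> * z) * x ^ l) sums (exp (of_real pi * \<i> * z) * (1 / (1 - x)))"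
    by (intro sums_mult geometric_sums)
  also have "(\<lambda>l. exp (of_real pi * \<i> * z) * x ^ l) = (\<lambda>l. exp (2 * of_real pi * \<i> * (of_nat l + 1/2) * z))"
    by (auto simp: x_def algebra_simps simp flip: exp_of_nat_mult exp_add)
  also have "exp (of_real pi * \<i> * z) * (1 / (1 - x)) = kern z"
  proof -
    have x: "x = exp (of_real pi * \<i> * z) * exp (of_real pi * \<i> * z)"
      by (simp add: x_def algebra_simps flip: exp_add)
    have "x \<noteq> 1" using \<open>norm x < 1\<close> by auto
    then show ?thesis
      unfolding kern_def sin_exp_eq unfolding x
      by (simp add: exp_minus divide_simps mult_ac) (simp add: algebra_simps)
  qed
  finally show ?thesis .
qed

section \<open>Lowering a line of integration\<close>

text \<open>
  A bound in every horizontal strip, with constants that may depend on the strip. It makes integrals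
  over horizontal lines converge absolutely and lets the short sides of long rectangles contribute
  nothing in the limit.
\<close>
definition strip_decay :: "(complex \<Rightarrow> complex) \<Rightarrow> bool" where
  "strip_decay f \<longleftrightarrow>
     (\<forall>Y. \<exists>C \<delta>. \<delta> > 0 \<and> (\<forall>z. \<bar>Im z\<bar> \<le> Y \<longrightarrow> norm (f z) \<le> C * exp (- \<delta> * (Re z)\<^sup>2)))"

lemma strip_decayE:
  assumes "strip_decay f"
  obtains C \<delta> where "\<delta> > 0" "\<And>z. \<bar>Im z\<bar> \<le> Y \<Longrightarrow> norm (f z) \<le> C * exp (- \<delta> * (Re z)\<^sup>2)" "C \<ge> 0"
proof -
  obtain C \<delta> where *: "\<delta> > 0" "\<And>z. \<bar>Im z\<bar> \<le> \<bar>Y\<bar> \<Longrightarrow> norm (f z) \<le> C * exp (- \<delta> * (Re z)\<^sup>2)"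
    using assms unfolding strip_decay_def by meson
  have "norm (f 0) \<le> C" using *(2)[of 0] by simp
  then have "C \<ge> 0" using norm_ge_zero[of "f 0"] by linarith
  show ?thesis by (rule that[OF *(1) _ \<open>C \<ge> 0\<close>], rule *(2)) linarith
qed

lemma strip_decay_translate:
  assumes "strip_decay f"
  shows "strip_decay (\<lambda>z. f (z + s))"
  unfolding strip_decay_def
proof
  fix Y
  obtain C \<delta> where *: "\<delta> > 0" "C \<ge> 0"
    "\<And>z. \<bar>Im z\<bar> \<le> \<bar>Y\<bar> + \<bar>Im s\<bar> \<Longrightarrow> norm (f z) \<le> C * exp (- \<delta> * (Re z)\<^sup>2)"
    using strip_decayE[OF assms] by metis
  have "norm (f (z + s)) \<le> C * exp (\<delta> * (Re s)\<^sup>2) * exp (- (\<delta> / 2) * (Re z)\<^sup>2)" if "\<bar>Im z\<bar> \<le> Y" for z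
  proof -
    have "norm (f (z + s)) \<le> C * exp (- \<delta> * (Re (z + s))\<^sup>2)"
      by (rule *(3)) (use that in auto)
    also have "\<dots> \<le> C * exp (\<delta> * (Re s)\<^sup>2 + - (\<delta> / 2) * (Re z)\<^sup>2)"
    proof -
      \<comment> \<open>Half of the decay is given up to pay for the translation.\<close>
      have "0 \<le> (Re z + 2 * Re s)\<^sup>2" by simp
      then have "(Re z)\<^sup>2 / 2 \<le> (Re z + Re s)\<^sup>2 + (Re s)\<^sup>2"
        by (simp add: power2_eq_square algebra_simps)
      then have "\<delta> * ((Re z)\<^sup>2 / 2) \<le> \<delta> * ((Re z + Re s)\<^sup>2 + (Re s)\<^sup>2)"
        using *(1) by (intro mult_left_mono) auto
      then show ?thesis using \<open>C \<ge> 0\<close> by (intro mult_left_mono) (auto simp: algebra_simps)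
    qed
    finally show ?thesis by (simp only: exp_add mult.assoc)
  qed
  with *(1) show "\<exists>C \<delta>. \<delta> > 0 \<and> (\<forall>z. \<bar>Im z\<bar> \<le> Y \<longrightarrow> norm (f (z + s)) \<le> C * exp (- \<delta> * (Re z)\<^sup>2))"
    by (intro exI[of _ "C * exp (\<delta> * (Re s)\<^sup>2)"] exI[of _ "\<delta> / 2"]) auto
qed

lemma strip_decay_integrable_line:
  assumes f: "f holomorphic_on UNIV" "strip_decay f"
    and [measurable]: "g \<in> borel_measurable borel" and g: "\<And>x. norm (g x) \<le> M"
  shows "integrable lborel (\<lambda>x. f (of_real x + s) * g x)"
proof -
  obtain C \<delta> where *: "\<delta> > 0" "C \<ge> 0"
    "\<And>z. \<bar>Im z\<bar> \<le> \<bar>Im s\<bar> \<Longrightarrow> norm (f z) \<le> C * exp (- \<delta> * (Re z)\<^sup>2)"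
    using strip_decayE[OF f(2)] by metis
  have [measurable]: "f \<in> borel_measurable borel"
    using holomorphic_on_imp_continuous_on[OF f(1)] by (rule borel_measurable_continuous_onI)
  have "integrable lborel (\<lambda>x. C * exp (- \<delta> * (x + Re s)\<^sup>2) * M)"
    using gaussian_integrable[OF *(1), of "Re s"] by simp
  then show ?thesis
  proof (rule Bochner_Integration.integrable_bound)
    show "AE x in lborel. norm (f (of_real x + s) * g x) \<le> norm (C * exp (- \<delta> * (x + Re s)\<^sup>2) * M)"
    proof (rule AE_I2)
      fix x
      have "norm (f (of_real x + s) * g x) \<le> (C * exp (- \<delta> * (x + Re s)\<^sup>2)) * M"
        unfolding norm_mult using *(3)[of "of_real x + s"] g \<open>C \<ge> 0\<close> by (intro mult_mono) auto
      then show "norm (f (of_real x + s) * g x) \<le> norm (C * exp (- \<delta> * (x + Re s)\<^sup>2) * M)" by simp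
    qed
  qed measurable
qed

lemma contour_integral_linepath_horizontal:
  fixes G :: "complex \<Rightarrow> complex"
  assumes "a < b"
  shows "contour_integral (linepath (Complex a y) (Complex b y)) G = integral {a..b} (\<lambda>x. G (of_real x + \<i> * of_real y))"
proof -
  have "(G has_contour_integral I) (linepath (Complex a y) (Complex b y)) \<longleftrightarrow>
     ((\<lambda>z. G (z + \<i> * of_real y)) has_contour_integral I) (linepath (of_real a) (of_real b))" for I
  proof -
    have *: "linepath (Complex a y) (Complex b y) x = linepath (of_real a) (of_real b) x + \<i> * of_real y" for x
      by (simp add: linepath_def complex_eq_iff algebra_simps)
    have **: "Complex b y - Complex a y = of_real b - of_real a" by (simp add: complex_eq_iff)
    show ?thesis unfolding has_contour_integral_linepath * ** ..
  qed
  then have "contour_integral (linepath (Complex a y) (Complex b y)) G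
     = contour_integral (linepath (of_real a) (of_real b)) (\<lambda>z. G (z + \<i> * of_real y))"
    by (simp add: contour_integral_def contour_integrable_on_def)
  also have "\<dots> = integral {a..b} (\<lambda>x. G (of_real x + \<i> * of_real y))"
    using assms by (subst contour_integral_linepath_Reals_eq) auto
  finally show ?thesis .
qed

lemma kern_holomorphic: "kern holomorphic_on - \<int>"
  unfolding kern_def [abs_def]
  by (intro holomorphic_intros) (auto simp: sin_pi_eq_0_iff_Ints)

text \<open>
  The derivative of \<open>sin (\<pi> z)\<close> at \<open>l\<close> is \<open>\<pi> cos (\<pi> l)\<close>, and \<open>cos (\<pi> l) = \<plusminus>1\<close> is its own inverse, so it
  may be written in the numerator.
\<close>
lemma residue_kern_mult:
  fixes f :: "complex \<Rightarrow> complex"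
  assumes f: "f holomorphic_on UNIV" and l: "l \<in> \<int>"
  shows "residue (\<lambda>z. f z * kern z) l = - f l * cos (of_real pi * l) / (2 * of_real pi * \<i>)"
proof (rule residue_simple')
  show "open (- (\<int> - {l}))"
    by (intro open_Compl closed_subset_Ints) auto
  have "- (\<int> - {l}) - {l} \<subseteq> - \<int>" using l by auto
  then show "(\<lambda>z. f z * kern z) holomorphic_on - (\<int> - {l}) - {l}"
    by (intro holomorphic_intros holomorphic_on_subset[OF kern_holomorphic] holomorphic_on_subset[OF f]) auto
  have s0: "sin (of_real pi * l) = 0" using l by (simp add: sin_pi_eq_0_iff_Ints)
  have c2: "cos (of_real pi * l) * cos (of_real pi * l) = 1"
    using sin_cos_squared_add[of "of_real pi * l"] s0 by (simp add: power2_eq_square)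
  then have c0: "cos (of_real pi * l) \<noteq> 0" by auto
  have "((\<lambda>w. sin (of_real pi * w)) has_field_derivative (cos (of_real pi * l) * of_real pi)) (at l)"
    by (auto intro!: derivative_eq_intros)
  then have "((\<lambda>w. sin (of_real pi * w) / (w - l)) \<longlongrightarrow> cos (of_real pi * l) * of_real pi) (at l)"
    by (simp add: has_field_derivative_iff s0)
  moreover have "(f \<longlongrightarrow> f l) (at l)"
    using holomorphic_on_imp_continuous_on[OF f] by (simp add: continuous_on_eq_continuous_at isCont_def)
  ultimately have "((\<lambda>w. - f w / (2 * \<i>) / (sin (of_real pi * w) / (w - l))) \<longlongrightarrow>
      - f l / (2 * \<i>) / (cos (of_real pi * l) * of_real pi)) (at l)"
    using c0 by (intro tendsto_intros) auto
  also have "(\<lambda>w. - f w / (2 * \<i>) / (sin (of_real pi * w) / (w - l))) = (\<lambda>w. f w * kern w * (w - l))"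
    by (auto simp: kern_def fun_eq_iff field_simps)
  also have "- f l / (2 * \<i>) / (cos (of_real pi * l) * of_real pi) = - f l * cos (of_real pi * l) / (2 * of_real pi * \<i>)"
    using c0 c2 by (simp add: field_simps)
  finally show "((\<lambda>w. f w * kern w * (w - l)) \<longlongrightarrow> - f l * cos (of_real pi * l) / (2 * of_real pi * \<i>)) (at l)" .
qed (use l in auto)

text \<open>
  The residue theorem for a rectangle whose vertical sides run half-way between integers, so that they
  stay away from the poles of the kernel. The residues come with the sign that makes them add to the
  lower side when the upper side is isolated.
\<close>
lemma kern_rectangle_residues:
  fixes f :: "complex \<Rightarrow> complex" and n :: nat
  defines "X \<equiv> real n + 1/2" and "G \<equiv> \<lambda>z. f z * kern z"
  assumes f: "f holomorphic_on UNIV" and c: "c0 > 0" "c1 > 0"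
  shows "integral {-X..X} (\<lambda>x. G (of_real x + \<i> * of_real c1)) =
      integral {-X..X} (\<lambda>x. G (of_real x - \<i> * of_real c0))
      + (\<Sum>l\<in>\<int> \<inter> {-X..X}. f (of_real l) * of_real (cos (pi * l)))
      + contour_integral (linepath (Complex X (-c0)) (Complex X c1)) G
      + contour_integral (linepath (Complex (-X) c1) (Complex (-X) (-c0))) G"
proof -
  define a1 where "a1 = Complex (-X) (-c0)"
  define a2 where "a2 = Complex X (-c0)"
  define a3 where "a3 = Complex X c1"
  define a4 where "a4 = Complex (-X) c1"
  note a = a1_def a2_def a3_def a4_def
  have "X > 0" unfolding X_def by simp
  have XnI: "X \<notin> \<int>" "- X \<notin> \<int>"
  proof -
    show "X \<notin> \<int>"
    proof
      assume "X \<in> \<int>"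
      then obtain k where "X = of_int k" by (elim Ints_cases)
      then have "real_of_int (2 * k) = real_of_int (2 * int n + 1)" by (simp add: X_def)
      then have "2 * k = 2 * int n + 1" by (simp only: of_int_eq_iff)
      then show False by presburger
    qed
    then show "- X \<notin> \<int>" by (simp add: minus_in_Ints_iff)
  qed
  have Ints_iff: "z \<in> \<int> \<longleftrightarrow> Im z = 0 \<and> Re z \<in> \<int>" for z :: complex
    by (metis complex_is_Int_iff Ints_cases Ints_of_int)
  define P where "P = complex_of_real ` (\<int> \<inter> {-X..X})"
  define S where "S = {z. Re z < X + 1/2} \<inter> {z. Re z > - (X + 1/2)}"
  have finI: "finite (\<int> \<inter> {-X..X})"
    using finite_int_segment[of "-X" X] by (rule rev_finite_subset) auto
  have SZ: "S \<inter> \<int> \<subseteq> P"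
  proof
    fix z assume "z \<in> S \<inter> \<int>"
    then obtain k where k: "z = of_int k" by (auto elim: Ints_cases)
    with \<open>z \<in> S \<inter> \<int>\<close> have "real_of_int k < real_of_int (int n + 1)" "real_of_int (- int n - 1) < real_of_int k"
      by (auto simp: S_def X_def)
    then have "\<bar>k\<bar> \<le> int n" unfolding of_int_less_iff by linarith
    then have "\<bar>real_of_int k\<bar> \<le> real n" by linarith
    then have "real_of_int k \<in> \<int> \<inter> {-X..X}" by (auto simp: X_def)
    then show "z \<in> P" unfolding P_def k by (intro image_eqI[of _ _ "real_of_int k"]) auto
  qed
  have Ghol: "G holomorphic_on - \<int>"
    unfolding G_def by (intro holomorphic_intros kern_holomorphic holomorphic_on_subset[OF f]) auto
  have pim: "path_image (rectpath a1 a3) \<subseteq> - \<int>"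
    using XnI c by (subst path_image_rectpath) (auto simp: a Ints_iff X_def)
  have "contour_integral (rectpath a1 a3) G = 2 * pi * \<i> * (\<Sum>p\<in>P. winding_number (rectpath a1 a3) p * residue G p)"
  proof (rule Residue_theorem)
    show "open S" unfolding S_def
      by (intro open_Int open_halfspace_Re_lt open_halfspace_Re_gt)
    show "connected S" unfolding S_def
      by (intro convex_connected convex_Int convex_halfspace_Re_lt convex_halfspace_Re_gt)
    show "finite P" unfolding P_def using finI by simp
    show "G holomorphic_on S - P"
      using SZ by (intro holomorphic_on_subset[OF Ghol]) auto
    have "P \<subseteq> \<int>" by (auto simp: P_def)
    then show "path_image (rectpath a1 a3) \<subseteq> S - P"
      using pim \<open>X > 0\<close> c
      by (subst path_image_rectpath) (auto simp: a S_def path_image_rectpath)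
    show "\<forall>z. z \<notin> S \<longrightarrow> winding_number (rectpath a1 a3) z = 0"
      using \<open>X > 0\<close> c by (auto intro!: winding_number_rectpath_outside simp: a S_def in_cbox_complex_iff)
  qed auto
  also have "(\<Sum>p\<in>P. winding_number (rectpath a1 a3) p * residue G p)
     = (\<Sum>l\<in>\<int> \<inter> {-X..X}. - f (of_real l) * of_real (cos (pi * l)) / (2 * of_real pi * \<i>))"
    unfolding P_def
  proof (subst sum.reindex, goal_cases)
    case 2
    show ?case
    proof (intro sum.cong refl, simp only: o_def)
      fix l assume l: "l \<in> \<int> \<inter> {- X..X}"
      have "l \<noteq> X" "l \<noteq> - X" using XnI l by auto
      then have "winding_number (rectpath a1 a3) (of_real l) = 1"
        using l c by (intro winding_number_rectpath) (auto simp: in_box_complex_iff a less_le)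
      then show "winding_number (rectpath a1 a3) (of_real l) * residue G (of_real l)
         = - f (of_real l) * of_real (cos (pi * l)) / (2 * of_real pi * \<i>)"
        unfolding G_def using l
        by (subst residue_kern_mult[OF f]) (auto simp: cos_of_real elim!: Ints_cases simp flip: of_real_mult)
    qed
  qed (auto intro!: inj_onI)
  also have "2 * pi * \<i> * \<dots> = - (\<Sum>l\<in>\<int> \<inter> {-X..X}. f (of_real l) * of_real (cos (pi * l)))"
    by (simp add: sum_distrib_left sum_negf)
  finally have 1: "contour_integral (rectpath a1 a3) G = - (\<Sum>l\<in>\<int> \<inter> {-X..X}. f (of_real l) * of_real (cos (pi * l)))" .
  have Gcont: "continuous_on (path_image (rectpath a1 a3)) G"
    using holomorphic_on_imp_continuous_on[OF Ghol] pim by (rule continuous_on_subset)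
  have pim_eq: "path_image (rectpath a1 a3) = closed_segment a1 a2 \<union> closed_segment a2 a3 \<union> closed_segment a3 a4 \<union> closed_segment a4 a1"
    by (simp add: rectpath_def Let_def path_image_join a Un_assoc)
  have ci: "G contour_integrable_on linepath a1 a2" "G contour_integrable_on linepath a2 a3"
    "G contour_integrable_on linepath a3 a4" "G contour_integrable_on linepath a4 a1"
    by (intro contour_integrable_continuous_linepath continuous_on_subset[OF Gcont]; auto simp: pim_eq)+
  have "contour_integral (rectpath a1 a3) G = contour_integral (linepath a1 a2) G + (contour_integral (linepath a2 a3) G
     + (contour_integral (linepath a3 a4) G + contour_integral (linepath a4 a1) G))"
  proof -
    have "rectpath a1 a3 = linepath a1 a2 +++ linepath a2 a3 +++ linepath a3 a4 +++ linepath a4 a1"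
      by (simp add: rectpath_def a Let_def)
    then show ?thesis using ci by simp
  qed
  moreover have "contour_integral (linepath a1 a2) G = integral {-X..X} (\<lambda>x. G (of_real x - \<i> * of_real c0))"
    unfolding a using \<open>X > 0\<close> by (subst contour_integral_linepath_horizontal) auto
  moreover have "contour_integral (linepath a3 a4) G = - integral {-X..X} (\<lambda>x. G (of_real x + \<i> * of_real c1))"
  proof -
    have "contour_integral (linepath a3 a4) G = - contour_integral (linepath a4 a3) G"
      by (intro contour_integral_reverse_linepath continuous_on_subset[OF Gcont]) (auto simp: pim_eq)
    then show ?thesis
      unfolding a using \<open>X > 0\<close> by (simp add: contour_integral_linepath_horizontal)
  qed
  ultimately show ?thesis using 1 by (simp add: a algebra_simps)
qed

text \<open>
  On the vertical line through a half-integer the sine is \<open>\<plusminus>cosh (\<pi> y)\<close>, hence at least \<open>1\<close> in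
  modulus. This bounds the kernel on the vertical sides independently of their position.
\<close>
lemma norm_kern_half_le:
  "norm (kern (Complex (of_int n + 1/2) y)) \<le> 1 / 2"
proof -
  define t where "t = pi * (of_int n + 1/2)"
  have c: "cos t = 0"
    unfolding t_def by (simp add: ring_distribs cos_add)
  then have s: "\<bar>sin t\<bar> = 1"
    using sin_cos_squared_add[of t] by (simp add: power2_eq_1_iff) auto
  have "of_real pi * Complex (of_int n + 1/2) y = of_real t + \<i> * of_real (pi * y)"
    by (simp add: complex_eq_iff t_def)
  then have "norm (sin (of_real pi * Complex (of_int n + 1/2) y)) = norm (cos (\<i> * of_real (pi * y)))"
    using c s by (simp only: sin_add sin_of_real cos_of_real norm_mult norm_of_real) (simp add: norm_mult)
  also have "cos (\<i> * of_real (pi * y)) = of_real (cosh (pi * y))"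
    unfolding cosh_conv_cos[symmetric]
    by (simp add: cosh_def scaleR_conv_of_real flip: exp_of_real)
  finally have "1 \<le> norm (sin (of_real pi * Complex (of_int n + 1/2) y))"
    using cosh_real_ge_1[of "pi * y"] by simp
  then have "1 / norm (sin (of_real pi * Complex (of_int n + 1/2) y)) \<le> 1"
    by (simp add: divide_le_eq_1)
  then show ?thesis by (simp add: kern_def norm_divide norm_mult)
qed

lemma vertical_side_tendsto_0:
  fixes f :: "complex \<Rightarrow> complex" and X :: "nat \<Rightarrow> real"
  assumes f: "f holomorphic_on UNIV" "strip_decay f"
    and X: "\<And>n. X n - 1/2 \<in> \<int>" "filterlim X at_infinity sequentially"
  shows "(\<lambda>n. contour_integral (linepath (Complex (X n) a) (Complex (X n) b)) (\<lambda>z. f z * kern z)) \<longlonglongrightarrow> 0"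
proof -
  obtain C \<delta> where *: "\<delta> > 0" "C \<ge> 0"
    "\<And>z. \<bar>Im z\<bar> \<le> \<bar>a\<bar> + \<bar>b\<bar> \<Longrightarrow> norm (f z) \<le> C * exp (- \<delta> * (Re z)\<^sup>2)"
    using strip_decayE[OF f(2)] by metis
  let ?B = "\<lambda>n. C * exp (- \<delta> * (X n)\<^sup>2) * (1 / 2)"
  have bound: "norm (contour_integral (linepath (Complex (X n) a) (Complex (X n) b)) (\<lambda>z. f z * kern z)) \<le> ?B n * \<bar>b - a\<bar>" for n
  proof -
    obtain k where k: "X n = of_int k + 1/2"
      using X(1)[of n] by (elim Ints_cases) (auto simp: algebra_simps)
    have seg: "Re z = X n \<and> \<bar>Im z\<bar> \<le> \<bar>a\<bar> + \<bar>b\<bar>" if "z \<in> closed_segment (Complex (X n) a) (Complex (X n) b)" for z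
      using that by (auto simp: closed_segment_same_Re closed_segment_eq_real_ivl split: if_splits)
    have "norm (contour_integral (linepath (Complex (X n) a) (Complex (X n) b)) (\<lambda>z. f z * kern z))
       \<le> ?B n * norm (Complex (X n) b - Complex (X n) a)"
    proof (rule contour_integral_bound_linepath)
      have "closed_segment (Complex (X n) a) (Complex (X n) b) \<subseteq> - \<int>"
      proof (intro subsetI ComplI)
        fix z assume z: "z \<in> closed_segment (Complex (X n) a) (Complex (X n) b)" "z \<in> \<int>"
        then obtain m where "z = of_int m" by (elim Ints_cases)
        with seg[OF z(1)] k have "real_of_int (2 * m) = real_of_int (2 * k + 1)" by simp
        then have "2 * m = 2 * k + 1" by (simp only: of_int_eq_iff)
        then show False by presburger
      qed
      then show "(\<lambda>z. f z * kern z) contour_integrable_on linepath (Complex (X n) a) (Complex (X n) b)"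
        by (intro contour_integrable_continuous_linepath continuous_on_mult
              continuous_on_subset[OF holomorphic_on_imp_continuous_on[OF kern_holomorphic]]
              continuous_on_subset[OF holomorphic_on_imp_continuous_on[OF f(1)]]) auto
      show "0 \<le> ?B n" using \<open>C \<ge> 0\<close> by simp
      fix z assume z: "z \<in> closed_segment (Complex (X n) a) (Complex (X n) b)"
      have "norm (kern z) \<le> 1 / 2"
      proof -
        have "z = Complex (of_int k + 1/2) (Im z)" using seg[OF z] k by (simp add: complex_eq_iff)
        then show ?thesis using norm_kern_half_le[of k "Im z"] by simp
      qed
      moreover have "norm (f z) \<le> C * exp (- \<delta> * (X n)\<^sup>2)"
        using *(3)[of z] seg[OF z] by auto
      ultimately show "norm (f z * kern z) \<le> ?B n"
        unfolding norm_mult using \<open>C \<ge> 0\<close> by (intro mult_mono) auto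
    qed
    also have "norm (Complex (X n) b - Complex (X n) a) = \<bar>b - a\<bar>"
      by (simp add: cmod_def)
    finally show ?thesis .
  qed
  have "(\<lambda>n. ?B n * \<bar>b - a\<bar>) \<longlonglongrightarrow> C * 0 * (1/2) * \<bar>b - a\<bar>"
  proof (intro tendsto_intros)
    have "((\<lambda>x::real. exp (- \<delta> * x\<^sup>2)) \<longlongrightarrow> 0) at_infinity"
    proof -
      have "((\<lambda>x::real. exp (- \<delta> * x\<^sup>2)) \<longlongrightarrow> 0) at_top" using *(1) by real_asymp
      moreover have "((\<lambda>x::real. exp (- \<delta> * x\<^sup>2)) \<longlongrightarrow> 0) at_bot" using *(1) by real_asymp
      ultimately show ?thesis by (simp add: at_infinity_eq_at_top_bot filterlim_sup)
    qed
    from filterlim_compose[OF this X(2)] show "(\<lambda>n. exp (- \<delta> * (X n)\<^sup>2)) \<longlonglongrightarrow> 0" .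
  qed
  then have "(\<lambda>n. ?B n * \<bar>b - a\<bar>) \<longlonglongrightarrow> 0" by simp
  with always_eventually[OF allI[OF bound]] show ?thesis by (rule Lim_null_comparison)
qed

lemma measurable_kern [measurable]: "kern \<in> borel_measurable borel"
  unfolding kern_def[abs_def] by measurable

text \<open>
  Letting the rectangle between the heights \<open>- c0\<close> and \<open>c1\<close> grow in width: only the real axis between
  the two lines carries poles, one at each integer.
\<close>
lemma residue_shift:
  fixes f :: "complex \<Rightarrow> complex"
  assumes f: "f holomorphic_on UNIV" "strip_decay f" and c: "c0 > 0" "c1 > 0"
  shows "(LINT x|lborel. f (of_real x + \<i> * of_real c1) * kern (of_real x + \<i> * of_real c1)) =
      (LINT x|lborel. f (of_real x - \<i> * of_real c0) * kern (of_real x - \<i> * of_real c0))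
      + (LINT l|count_space \<int>. f (of_real l) * of_real (cos (pi * l)))"
proof -
  define X where "X = (\<lambda>n. real n + 1/2)"
  define G where "G = (\<lambda>z. f z * kern z)"
  have X_eventually: "\<forall>\<^sub>F n in sequentially. - X n \<le> x \<and> x \<le> X n" for x
    using eventually_ge_at_top[of "nat \<lceil>\<bar>x\<bar>\<rceil>"] unfolding X_def by eventually_elim linarith
  have int: "integrable lborel (\<lambda>x. G (of_real x + s))" if "Im s \<noteq> 0" for s
    unfolding G_def
  proof (rule strip_decay_integrable_line[OF f])
    show "norm (kern (of_real x + s)) \<le> 1 / (2 * \<bar>sinh (pi * Im s)\<bar>)" for x
      using norm_kern_le[of "of_real x + s"] that by simp
  qed measurable
  have lim: "(\<lambda>n. integral {- X n..X n} (\<lambda>x. G (of_real x + s))) \<longlonglongrightarrow> (LINT x|lborel. G (of_real x + s))"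
    if "Im s \<noteq> 0" for s
  proof -
    have "(\<lambda>n. LINT x:{- X n..X n}|lborel. G (of_real x + s)) \<longlonglongrightarrow> (LINT x|lborel. G (of_real x + s))"
    proof (rule integral_exhaustion[OF int[OF that]])
      fix x :: real
      show "\<forall>\<^sub>F n in sequentially. x \<in> {- X n..X n}"
        using X_eventually[of x] by (auto elim!: eventually_mono)
    qed auto
    moreover have "(LINT x:{- X n..X n}|lborel. G (of_real x + s)) = integral {- X n..X n} (\<lambda>x. G (of_real x + s))" for n
      by (rule set_borel_integral_eq_integral) (use int[OF that] in \<open>auto simp: set_integrable_def intro!: integrable_mult_indicator\<close>)
    ultimately show ?thesis by simp
  qed
  have sumlim: "(\<lambda>n. \<Sum>l\<in>\<int> \<inter> {- X n..X n}. f (of_real l) * of_real (cos (pi * l)))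
     \<longlonglongrightarrow> (LINT l|count_space \<int>. f (of_real l) * of_real (cos (pi * l)))"
  proof -
    obtain C \<delta> where *: "\<delta> > 0" "C \<ge> 0"
      "\<And>z. \<bar>Im z\<bar> \<le> 0 \<Longrightarrow> norm (f z) \<le> C * exp (- \<delta> * (Re z)\<^sup>2)"
      using strip_decayE[OF f(2)] by metis
    have "integrable (count_space \<int>) (\<lambda>x. C * exp (- \<delta> * (x + 0)\<^sup>2))"
      by (intro integrable_mult_right gaussian_summable_Ints *)
    then have intZ: "integrable (count_space \<int>) (\<lambda>l. f (of_real l) * of_real (cos (pi * l)))"
    proof (rule Bochner_Integration.integrable_bound)
      show "AE l in count_space \<int>. norm (f (of_real l) * of_real (cos (pi * l))) \<le> norm (C * exp (- \<delta> * (l + 0)\<^sup>2))"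
      proof (rule AE_I2)
        fix l :: real
        have "norm (f (of_real l) * of_real (cos (pi * l))) \<le> (C * exp (- \<delta> * l\<^sup>2)) * 1"
          unfolding norm_mult using *(3)[of "of_real l"] *(2) by (intro mult_mono) auto
        then show "norm (f (of_real l) * of_real (cos (pi * l))) \<le> norm (C * exp (- \<delta> * (l + 0)\<^sup>2))"
          using *(2) by simp
      qed
    qed simp
    have "(\<lambda>n. LINT l:(\<int> \<inter> {- X n..X n})|count_space \<int>. f (of_real l) * of_real (cos (pi * l)))
     \<longlonglongrightarrow> (LINT l|count_space \<int>. f (of_real l) * of_real (cos (pi * l)))"
    proof (rule integral_exhaustion[OF intZ])
      fix x :: real assume "x \<in> space (count_space \<int>)"
      then show "\<forall>\<^sub>F n in sequentially. x \<in> \<int> \<inter> {- X n..X n}"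
        using X_eventually[of x] by (auto elim!: eventually_mono)
    qed auto
    moreover have "(LINT l:(\<int> \<inter> {- X n..X n})|count_space \<int>. f (of_real l) * of_real (cos (pi * l)))
      = (\<Sum>l\<in>\<int> \<inter> {- X n..X n}. f (of_real l) * of_real (cos (pi * l)))" for n
    proof -
      have "finite (\<int> \<inter> {- X n..X n})"
        using finite_int_segment[of "-X n" "X n"] by (rule rev_finite_subset) auto
      then show ?thesis
        by (subst infsetsum_altdef'[symmetric]) auto
    qed
    ultimately show ?thesis by simp
  qed
  have XL: "filterlim X at_infinity sequentially" "filterlim (\<lambda>n. - X n) at_infinity sequentially"
    unfolding X_def by real_asymp+
  have XI: "X n - 1/2 \<in> \<int>" "- X n - 1/2 \<in> \<int>" for n
  proof -
    have "- X n - 1/2 = of_int (- int n - 1)" by (simp add: X_def)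
    then show "- X n - 1/2 \<in> \<int>" by (metis Ints_of_int)
  qed (auto simp: X_def)
  have "(\<lambda>n. integral {- X n..X n} (\<lambda>x. G (of_real x + (- \<i> * of_real c0)))
      + (\<Sum>l\<in>\<int> \<inter> {- X n..X n}. f (of_real l) * of_real (cos (pi * l)))
      + contour_integral (linepath (Complex (X n) (-c0)) (Complex (X n) c1)) G
      + contour_integral (linepath (Complex (-X n) c1) (Complex (-X n) (-c0))) G)
     \<longlonglongrightarrow> (LINT x|lborel. G (of_real x + (- \<i> * of_real c0)))
       + (LINT l|count_space \<int>. f (of_real l) * of_real (cos (pi * l))) + 0 + 0"
    using c unfolding G_def
    by (intro tendsto_add sumlim lim[unfolded G_def] vertical_side_tendsto_0 f XI XL) auto
  also have "(\<lambda>n. integral {- X n..X n} (\<lambda>x. G (of_real x + (- \<i> * of_real c0)))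
      + (\<Sum>l\<in>\<int> \<inter> {- X n..X n}. f (of_real l) * of_real (cos (pi * l)))
      + contour_integral (linepath (Complex (X n) (-c0)) (Complex (X n) c1)) G
      + contour_integral (linepath (Complex (-X n) c1) (Complex (-X n) (-c0))) G)
      = (\<lambda>n. integral {- X n..X n} (\<lambda>x. G (of_real x + \<i> * of_real c1)))"
    using kern_rectangle_residues[OF f(1) c] unfolding X_def G_def by auto
  finally have "(LINT x|lborel. G (of_real x + \<i> * of_real c1)) = (LINT x|lborel. G (of_real x + (- \<i> * of_real c0)))
       + (LINT l|count_space \<int>. f (of_real l) * of_real (cos (pi * l))) + 0 + 0"
    using c by (intro LIMSEQ_unique[OF lim]) auto
  then show ?thesis by (simp add: G_def)
qed

text \<open>
  A height above \<open>Re e\<close>, so that the geometric series for \<open>kern (z - i e)\<close> converges there. For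
  \<open>Re e < 0\<close> the real axis itself will do, and no contour has to be moved.
\<close>
definition raised :: "complex \<Rightarrow> real" where
  "raised e = (if Re e > 0 then Re e + 1 else 0)"

lemma line_integral_translate:
  fixes f :: "complex \<Rightarrow> complex"
  shows "(LINT x|lborel. f (of_real x + of_real t)) = (LINT x|lborel. f (of_real x))"
  using lborel_integral_real_affine[of 1 "\<lambda>x. f (of_real x)" t] by (simp add: add.commute)

text \<open>
  The translation \<open>z \<mapsto> z + i e\<close> carries the poles \<open>\<int> + i e\<close> of \<open>kern (z - i e)\<close> to the integers, the
  situation of \<open>residue_shift\<close>. If \<open>Re e < 0\<close>, both lines are the real axis and the factor
  \<open>(1 + sgn (Re e)) / 2\<close> is zero; if \<open>Re e > 0\<close>, it is one.
\<close>
lemma contour_step: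
  fixes f :: "complex \<Rightarrow> complex"
  assumes f: "f holomorphic_on UNIV" "strip_decay f" and e: "Re e \<noteq> 0"
  shows "(LINT x|lborel. f (of_real x + \<i> * of_real (raised e)) * kern (of_real x + \<i> * of_real (raised e) - \<i> * e)) =
      (LINT x|lborel. f (of_real x) * kern (of_real x - \<i> * e))
      + of_real ((1 + sgn (Re e)) / 2) * (LINT l|count_space \<int>. f (of_real l + \<i> * e) * of_real (cos (pi * l)))"
proof (cases "Re e > 0")
  case False
  with e show ?thesis by (simp add: raised_def)
next
  case True
  have "(LINT x|lborel. f (of_real x + \<i> * of_real 1 + \<i> * e) * kern (of_real x + \<i> * of_real 1)) =
      (LINT x|lborel. f (of_real x - \<i> * of_real (Re e) + \<i> * e) * kern (of_real x - \<i> * of_real (Re e)))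
      + (LINT l|count_space \<int>. f (of_real l + \<i> * e) * of_real (cos (pi * l)))"
    using True by (intro residue_shift[of "\<lambda>z. f (z + \<i> * e)"] strip_decay_translate f)
      (auto intro!: holomorphic_on_compose_gen[OF _ f(1), unfolded o_def] holomorphic_intros)
  also have "(LINT x|lborel. f (of_real x + \<i> * of_real 1 + \<i> * e) * kern (of_real x + \<i> * of_real 1))
     = (LINT x|lborel. f (of_real x + \<i> * of_real (raised e)) * kern (of_real x + \<i> * of_real (raised e) - \<i> * e))"
  proof -
    have 1: "of_real x + of_real (Im e) + \<i> * of_real 1 + \<i> * e = of_real x + \<i> * of_real (raised e)"
      and 2: "of_real x + of_real (Im e) + \<i> * of_real 1 = of_real x + \<i> * of_real (raised e) - \<i> * e" for x
      using True by (simp_all add: raised_def complex_eq_iff)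
    show ?thesis
      using line_integral_translate[of "\<lambda>z. f (z + \<i> * of_real 1 + \<i> * e) * kern (z + \<i> * of_real 1)" "Im e"]
      unfolding 1 unfolding 2 by (rule sym)
  qed
  also have "(LINT x|lborel. f (of_real x - \<i> * of_real (Re e) + \<i> * e) * kern (of_real x - \<i> * of_real (Re e)))
     = (LINT x|lborel. f (of_real x) * kern (of_real x - \<i> * e))"
  proof -
    have 1: "of_real x + of_real (Im e) - \<i> * of_real (Re e) + \<i> * e = of_real x"
      and 2: "of_real x + of_real (Im e) - \<i> * of_real (Re e) = of_real x - \<i> * e" for x
      using True by (simp_all add: complex_eq_iff)
    show ?thesis
      using line_integral_translate[of "\<lambda>z. f (z - \<i> * of_real (Re e) + \<i> * e) * kern (z - \<i> * of_real (Re e))" "Im e"]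
      unfolding 1 unfolding 2 by (rule sym)
  qed
  finally show ?thesis using True by simp
qed

lemma norm_sin_le_exp: "norm (sin z) \<le> exp \<bar>Im z\<bar>" for z :: complex
proof -
  have "norm (sin z) \<le> (norm (exp (\<i> * z)) + norm (exp (- (\<i> * z)))) / 2"
    unfolding sin_exp_eq norm_divide norm_mult
    using norm_triangle_ineq4[of "exp (\<i> * z)" "exp (- (\<i> * z))"] by (simp del: norm_exp_eq_Re)
  also have "\<dots> \<le> (exp \<bar>Im z\<bar> + exp \<bar>Im z\<bar>) / 2"
    by (intro divide_right_mono add_mono) auto
  finally show ?thesis by simp
qed

text \<open>
  Multiplying \<open>f\<close> by \<open>- 2 i sin (\<pi> z)\<close> cancels the kernel and makes every residue vanish, so that
  moving a line without meeting poles is a special case of \<open>residue_shift\<close>.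
\<close>
lemma line_integral_shift_imaginary:
  fixes f :: "complex \<Rightarrow> complex"
  assumes f: "f holomorphic_on UNIV" "strip_decay f" and c: "c0 > 0" "c1 > 0"
  shows "(LINT x|lborel. f (of_real x + \<i> * of_real c1)) = (LINT x|lborel. f (of_real x - \<i> * of_real c0))"
proof -
  define g where "g = (\<lambda>z. f z * (- 2 * \<i> * sin (of_real pi * z)))"
  have "g holomorphic_on UNIV" unfolding g_def by (intro holomorphic_intros f)
  moreover have "strip_decay g"
    unfolding strip_decay_def
  proof
    fix Y
    obtain C \<delta> where *: "\<delta> > 0" "C \<ge> 0"
      "\<And>z. \<bar>Im z\<bar> \<le> Y \<Longrightarrow> norm (f z) \<le> C * exp (- \<delta> * (Re z)\<^sup>2)"
      using strip_decayE[OF f(2)] by metis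
    have "norm (g z) \<le> C * (2 * exp (pi * Y)) * exp (- \<delta> * (Re z)\<^sup>2)" if "\<bar>Im z\<bar> \<le> Y" for z
    proof -
      have "norm (sin (of_real pi * z)) \<le> exp (pi * Y)"
        using norm_sin_le_exp[of "of_real pi * z"] that by (auto simp: abs_mult elim!: order_trans)
      then have "norm (g z) \<le> (C * exp (- \<delta> * (Re z)\<^sup>2)) * (2 * exp (pi * Y))"
        unfolding g_def norm_mult using *(3)[OF that] *(2) by (intro mult_mono) auto
      then show ?thesis by (simp add: mult_ac)
    qed
    with *(1) show "\<exists>C \<delta>. \<delta> > 0 \<and> (\<forall>z. \<bar>Im z\<bar> \<le> Y \<longrightarrow> norm (g z) \<le> C * exp (- \<delta> * (Re z)\<^sup>2))"
      by blast
  qed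
  ultimately have "(LINT x|lborel. g (of_real x + \<i> * of_real c1) * kern (of_real x + \<i> * of_real c1)) =
      (LINT x|lborel. g (of_real x - \<i> * of_real c0) * kern (of_real x - \<i> * of_real c0))
      + (LINT l|count_space \<int>. g (of_real l) * of_real (cos (pi * l)))"
    using c by (rule residue_shift)
  moreover have sin0: "sin (of_real pi * of_real l :: complex) = 0" if "l \<in> \<int>" for l :: real
    unfolding sin_pi_eq_0_iff_Ints using that by (auto elim!: Ints_cases)
  moreover have "(LINT l|count_space \<int>. g (of_real l) * of_real (cos (pi * l))) = (LINT l|count_space (\<int>::real set). 0)"
    by (intro Bochner_Integration.integral_cong refl)
       (use sin0 in \<open>simp add: g_def\<close>)
  moreover have "g z * kern z = f z" if "Im z \<noteq> 0" for z
  proof -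
    have "sin (of_real pi * z) \<noteq> 0" using that by (auto simp: sin_pi_eq_0_iff_Ints elim!: Ints_cases)
    then show ?thesis by (simp add: g_def kern_def)
  qed
  ultimately show ?thesis using c by simp
qed

text \<open>
  Real translations do not change the Lebesgue integral; for the imaginary part the two heights are
  placed symmetrically around their midpoint.
\<close>
lemma line_integral_shift:
  fixes f :: "complex \<Rightarrow> complex"
  assumes f: "f holomorphic_on UNIV" "strip_decay f"
  shows "(LINT x|lborel. f (of_real x + s)) = (LINT x|lborel. f (of_real x))"
proof -
  have hol: "(\<lambda>z. f (z + w)) holomorphic_on UNIV" for w
    by (auto intro!: holomorphic_on_compose_gen[OF _ f(1), unfolded o_def] holomorphic_intros)
  have up: "(LINT x|lborel. f (of_real x + w + \<i> * of_real y)) = (LINT x|lborel. f (of_real x + w))"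
    if "y > 0" for w y
    using line_integral_shift_imaginary[of "\<lambda>z. f (z + (w + \<i> * of_real (y/2)))" "y/2" "y/2", OF hol strip_decay_translate[OF f(2)]] that
    by (simp add: algebra_simps)
  have "(LINT x|lborel. f (of_real x + s)) = (LINT x|lborel. f (of_real x + of_real (Re s)))"
  proof (cases "Im s" "0 :: real" rule: linorder_cases)
    case greater
    from up[OF this, of "of_real (Re s)"] show ?thesis
      by (simp add: add.assoc flip: complex_eq)
  next
    case less
    have eq: "s + \<i> * of_real (- Im s) = of_real (Re s)" by (simp add: complex_eq_iff)
    from less have "0 < - Im s" by simp
    from up[OF this, of s, unfolded add.assoc eq] show ?thesis by (rule sym)
  next
    case equal
    then have "s = of_real (Re s)" by (simp add: complex_eq_iff)
    then show ?thesis by simp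
  qed
  also have "\<dots> = (LINT x|lborel. f (of_real x))"
    by (subst (2) lborel_integral_real_affine[of 1 _ "Re s"]) (auto simp: add.commute)
  finally show ?thesis .
qed

section \<open>One-dimensional Gaussian integrals\<close>

lemma gaussian_integral_real:
  fixes a :: real
  assumes "a > 0"
  shows "(LINT x|lborel. exp (- (pi * a * x\<^sup>2))) = 1 / sqrt a"
proof -
  define \<sigma> where "\<sigma> = sqrt (1 / (2 * pi * a))"
  have \<sigma>: "\<sigma> > 0" "\<sigma>\<^sup>2 = 1 / (2 * pi * a)" using assms by (auto simp: \<sigma>_def)
  have "normal_density 0 \<sigma> = (\<lambda>x. sqrt a * exp (- (pi * a * x\<^sup>2)))"
    unfolding normal_density_def \<sigma>(2) using assms
    by (auto simp: fun_eq_iff real_sqrt_divide field_simps)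
  with integral_normal_density[OF \<sigma>(1), of 0] have "sqrt a * (LINT x|lborel. exp (- (pi * a * x\<^sup>2))) = 1"
    by simp
  then show ?thesis using assms by (simp add: field_simps)
qed

lemma gaussian_exp_integrable:
  fixes a :: complex
  assumes "Re a > 0"
  shows "integrable lborel (\<lambda>x. exp (- (of_real pi * a * of_real x ^ 2)))"
proof (rule Bochner_Integration.integrable_bound)
  show "integrable lborel (\<lambda>x. exp (- (pi * Re a) * (x + 0)\<^sup>2))"
    by (rule gaussian_integrable) (use assms in auto)
  show "AE x in lborel. norm (exp (- (of_real pi * a * of_real x ^ 2))) \<le> norm (exp (- (pi * Re a) * (x + 0)\<^sup>2))"
    by (intro AE_I2) (simp flip: of_real_power)
qed measurable

text \<open>
  The integrals over bounded intervals are holomorphic in \<open>a\<close>, and they converge locally uniformly,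
  because for \<open>Re a \<ge> r\<close> the tails are dominated by those of the real Gaussian with parameter \<open>r\<close>.
\<close>
lemma gaussian_integral_holomorphic:
  "(\<lambda>a::complex. LINT x|lborel. exp (- (of_real pi * a * of_real x ^ 2))) holomorphic_on {a. Re a > 0}"
    (is "?F holomorphic_on _")
proof (rule holomorphic_uniform_sequence)
  let ?e = "\<lambda>a x. exp (- (of_real pi * a * of_real x ^ 2)) :: complex"
  let ?Fn = "\<lambda>(n::nat) a. integral (cbox (- real n) (real n)) (?e a)"
  show "open {a::complex. Re a > 0}" by (rule open_halfspace_Re_gt)
  show "?Fn n holomorphic_on {a. Re a > 0}" for n
  proof (rule leibniz_rule_holomorphic)
    show "((\<lambda>a. ?e a x) has_field_derivative (- (of_real pi * of_real x ^ 2) * ?e a x)) (at a within {a. Re a > 0})" for a x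
      by (auto intro!: derivative_eq_intros)
    show "?e a integrable_on cbox (- real n) (real n)" for a
      by (intro integrable_continuous continuous_intros)
    show "continuous_on ({a. Re a > 0} \<times> cbox (- real n) (real n)) (\<lambda>(a, x). - (of_real pi * of_real x ^ 2) * ?e a x)"
      unfolding split_def by (intro continuous_intros)
  qed (rule convex_halfspace_Re_gt)
  fix a0 :: complex assume "a0 \<in> {a. Re a > 0}"
  then have a0: "Re a0 > 0" by simp
  define r where "r = Re a0 / 2"
  have r: "r > 0" using a0 by (simp add: r_def)
  have ra: "Re a \<ge> r" if "a \<in> cball a0 r" for a
  proof -
    have "\<bar>Re (a0 - a)\<bar> \<le> r" using that abs_Re_le_cmod[of "a0 - a"] by (simp add: dist_norm)
    then have "\<bar>Re a0 - Re a\<bar> \<le> Re a0 / 2" by (simp add: r_def)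
    then show ?thesis unfolding r_def by linarith
  qed
  define g where "g = (\<lambda>x. exp (- (pi * r) * (x + 0)\<^sup>2))"
  have g: "integrable lborel g" unfolding g_def by (rule gaussian_integrable) (use r in auto)
  define E where "E = (\<lambda>n::nat. (LINT x|lborel. g x) - (LINT x:cbox (- real n) (real n)|lborel. g x))"
  have "E \<longlonglongrightarrow> (LINT x|lborel. g x) - (LINT x|lborel. g x)"
    unfolding E_def
  proof (intro tendsto_intros integral_exhaustion[OF g])
    fix x :: real
    show "\<forall>\<^sub>F n in sequentially. x \<in> cbox (- real n) (real n)"
      using eventually_ge_at_top[of "nat \<lceil>\<bar>x\<bar>\<rceil>"] by eventually_elim (auto; linarith)
  qed auto
  then have E0: "E \<longlonglongrightarrow> 0" by simp
  have bound: "dist (?Fn n a) (?F a) \<le> E n" if "a \<in> cball a0 r" for n a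
  proof -
    have pos: "Re a > 0" using ra[OF that] r by simp
    note int = gaussian_exp_integrable[OF pos]
    have si: "set_integrable lborel (cbox (- real n) (real n)) (?e a)"
      unfolding set_integrable_def by (intro integrable_mult_indicator int) auto
    have sg: "set_integrable lborel (cbox (- real n) (real n)) g"
      unfolding set_integrable_def by (intro integrable_mult_indicator g) auto
    have "?F a - ?Fn n a = (LINT x|lborel. ?e a x) - (LINT x:cbox (- real n) (real n)|lborel. ?e a x)"
      using set_borel_integral_eq_integral(2)[OF si] by simp
    also have "\<dots> = (LINT x|lborel. ?e a x - indicator (cbox (- real n) (real n)) x *\<^sub>R ?e a x)"
      unfolding set_lebesgue_integral_def
      by (rule Bochner_Integration.integral_diff[symmetric]) (use int si in \<open>auto simp: set_integrable_def\<close>)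
    also have "norm \<dots> \<le> (LINT x|lborel. g x - indicator (cbox (- real n) (real n)) x *\<^sub>R g x)"
    proof (rule Bochner_Integration.integral_norm_bound_integral)
      show "integrable lborel (\<lambda>x. ?e a x - indicator (cbox (- real n) (real n)) x *\<^sub>R ?e a x)"
        using int si by (auto simp: set_integrable_def)
      show "integrable lborel (\<lambda>x. g x - indicator (cbox (- real n) (real n)) x *\<^sub>R g x)"
        using g sg by (auto simp: set_integrable_def)
      fix x :: real
      have "norm (?e a x) \<le> g x"
        using ra[OF that] by (auto simp: g_def mult_right_mono simp flip: of_real_power)
      then show "norm (?e a x - indicator (cbox (- real n) (real n)) x *\<^sub>R ?e a x) \<le> g x - indicator (cbox (- real n) (real n)) x *\<^sub>R g x"
        by (auto simp: indicator_def)
    qed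
    also have "\<dots> = E n"
      unfolding E_def set_lebesgue_integral_def
      by (rule Bochner_Integration.integral_diff) (use g sg in \<open>auto simp: set_integrable_def\<close>)
    finally show ?thesis by (simp add: dist_norm norm_minus_commute)
  qed
  have "uniform_limit (cball a0 r) ?Fn ?F sequentially"
  proof (rule uniform_limitI)
    fix \<eta> :: real assume "\<eta> > 0"
    with E0 have "\<forall>\<^sub>F n in sequentially. E n < \<eta>" by (rule order_tendstoD)
    then show "\<forall>\<^sub>F n in sequentially. \<forall>a\<in>cball a0 r. dist (?Fn n a) (?F a) < \<eta>"
      by eventually_elim (intro ballI le_less_trans[OF bound])
  qed
  moreover have "cball a0 r \<subseteq> {a. Re a > 0}" using ra r by force
  ultimately show "\<exists>d>0. cball a0 d \<subseteq> {a. Re a > 0} \<and> uniform_limit (cball a0 d) ?Fn ?F sequentially"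
    using r by blast
qed

text \<open>
  The principal square root is holomorphic on the right half-plane, so the identity theorem extends the
  evaluation from positive real parameters.
\<close>
lemma gaussian_integral_complex:
  fixes a :: complex
  assumes "Re a > 0"
  shows "(LINT x|lborel. exp (- (of_real pi * a * of_real x ^ 2))) = 1 / csqrt a"
proof -
  define h where "h = (\<lambda>a::complex. (LINT x|lborel. exp (- (of_real pi * a * of_real x ^ 2))) - 1 / csqrt a)"
  have "h a = 0"
  proof (rule analytic_continuation[of h "{a. Re a > 0}" "of_real ` {0<..}" 1 a])
    show "h holomorphic_on {a. Re a > 0}"
      unfolding h_def
      by (intro holomorphic_intros gaussian_integral_holomorphic) (auto simp: complex_nonpos_Reals_iff)
    show "connected {a::complex. Re a > 0}" by (intro convex_connected convex_halfspace_Re_gt)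
    show "(1::complex) islimpt of_real ` {0<..}"
      unfolding islimpt_approachable
    proof (intro allI impI)
      fix e :: real assume "e > 0"
      then show "\<exists>x'\<in>complex_of_real ` {0<..}. x' \<noteq> 1 \<and> dist x' 1 < e"
        by (intro bexI[of _ "of_real (1 + e / 2)"] imageI) (auto simp: dist_norm norm_divide)
    qed
    fix z :: complex assume "z \<in> of_real ` {0<..}"
    then obtain x where x: "z = of_real x" "x > 0" by auto
    have "(LINT y|lborel. exp (- (of_real pi * z * of_real y ^ 2))) = (LINT y|lborel. of_real (exp (- (pi * x * y\<^sup>2))))"
      by (simp add: x exp_of_real[symmetric])
    also have "\<dots> = of_real (1 / sqrt x)"
      unfolding integral_complex_of_real gaussian_integral_real[OF x(2)] ..
    finally show "h z = 0" using x by (simp add: h_def)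
  qed (use assms in \<open>auto intro: open_halfspace_Re_gt\<close>)
  then show ?thesis by (simp add: h_def)
qed

lemma strip_decay_gaussian:
  assumes "Re a > 0"
  shows "strip_decay (\<lambda>z. exp (- (of_real pi * a * z\<^sup>2)))"
  unfolding strip_decay_def
proof
  fix Y :: real
  define \<delta> where "\<delta> = pi * Re a / 2"
  define M where "M = pi * Re a * Y\<^sup>2 + 2 * pi * (Im a)\<^sup>2 * Y\<^sup>2 / Re a"
  have "norm (exp (- (of_real pi * a * z\<^sup>2))) \<le> exp M * exp (- \<delta> * (Re z)\<^sup>2)" if "\<bar>Im z\<bar> \<le> Y" for z
  proof -
    have y: "(Im z)\<^sup>2 \<le> Y\<^sup>2" using that by (simp add: abs_le_square_iff[symmetric])
    \<comment> \<open>The mixed term is absorbed by half of the decay in \<open>Re z\<close>.\<close>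
    have "0 \<le> (Re a * Re z - 2 * Im a * Im z)\<^sup>2" by simp
    then have "4 * Re a * Re z * Im a * Im z \<le> (Re a)\<^sup>2 * (Re z)\<^sup>2 + 4 * (Im a)\<^sup>2 * (Im z)\<^sup>2"
      by (simp add: power2_eq_square algebra_simps)
    also have "\<dots> \<le> (Re a)\<^sup>2 * (Re z)\<^sup>2 + 4 * (Im a)\<^sup>2 * Y\<^sup>2"
      using y by (intro add_mono mult_left_mono) auto
    finally have "2 * Re z * Im a * Im z \<le> Re a * (Re z)\<^sup>2 / 2 + 2 * (Im a)\<^sup>2 * Y\<^sup>2 / Re a"
      using assms by (simp add: field_simps power2_eq_square)
    then have "pi * (2 * Re z * Im a * Im z) \<le> pi * (Re a * (Re z)\<^sup>2 / 2 + 2 * (Im a)\<^sup>2 * Y\<^sup>2 / Re a)"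
      by (intro mult_left_mono) auto
    moreover have "pi * (Re a * (Im z)\<^sup>2) \<le> pi * (Re a * Y\<^sup>2)"
      using y assms by (intro mult_left_mono) auto
    moreover have Re: "Re (- (of_real pi * a * z\<^sup>2)) = - pi * (Re a * (Re z)\<^sup>2) + pi * (Re a * (Im z)\<^sup>2) + pi * (2 * Re z * Im a * Im z)"
      by (simp add: power2_eq_square algebra_simps)
    moreover have "M + - \<delta> * (Re z)\<^sup>2 = pi * (Re a * Y\<^sup>2)
        + pi * (Re a * (Re z)\<^sup>2 / 2 + 2 * (Im a)\<^sup>2 * Y\<^sup>2 / Re a) - pi * (Re a * (Re z)\<^sup>2)"
      by (simp add: M_def \<delta>_def algebra_simps)
    ultimately have "Re (- (of_real pi * a * z\<^sup>2)) \<le> M + - \<delta> * (Re z)\<^sup>2"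
      unfolding Re by linarith
    then show ?thesis by (simp only: norm_exp_eq_Re exp_le_cancel_iff flip: exp_add)
  qed
  then show "\<exists>C \<delta>. \<delta> > 0 \<and> (\<forall>z. \<bar>Im z\<bar> \<le> Y \<longrightarrow> norm (exp (- (of_real pi * a * z\<^sup>2))) \<le> C * exp (- \<delta> * (Re z)\<^sup>2))"
    using assms by (intro exI[of _ "exp M"] exI[of _ \<delta>]) (auto simp: \<delta>_def)
qed

lemma gaussian_integral_shifted:
  assumes "Re a > 0"
  shows "(LINT x|lborel. exp (- (of_real pi * a * (of_real x + s)\<^sup>2))) = 1 / csqrt a"
proof -
  have "(\<lambda>z. exp (- (of_real pi * a * z\<^sup>2))) holomorphic_on UNIV" by (intro holomorphic_intros)
  from line_integral_shift[OF this strip_decay_gaussian[OF assms], of s] gaussian_integral_complex[OF assms]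
  show ?thesis by simp
qed

section \<open>Lebesgue measure in coordinates and linear maps\<close>

lemma Basis_real_vec: "(Basis :: (real^'n) set) = (\<lambda>j. axis j 1) ` UNIV"
  by (auto simp: Basis_vec_def)

lemma prod_Basis_vec: "(\<Prod>b\<in>(Basis :: (real^'n) set). g b) = (\<Prod>j\<in>UNIV. g (axis j 1))"
  unfolding Basis_real_vec by (subst prod.reindex) (auto simp: inj_on_def axis_eq_axis)

lemma measurable_vec_lambda [measurable]:
  "vec_lambda \<in> (\<Pi>\<^sub>M j\<in>(UNIV :: 'n::finite set). (lborel :: real measure)) \<rightarrow>\<^sub>M (borel :: (real^'n) measure)"
proof (subst borel_measurable_euclidean_space, rule ballI)
  fix b :: "real^'n" assume "b \<in> Basis"
  then obtain j where "b = axis j 1" by (auto simp: Basis_real_vec)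
  then show "(\<lambda>x. vec_lambda x \<bullet> b) \<in> borel_measurable (\<Pi>\<^sub>M j\<in>(UNIV :: 'n set). (lborel :: real measure))"
    by (simp add: cart_eq_inner_axis[symmetric])
qed

interpretation lborel_product: product_sigma_finite "\<lambda>_. lborel :: real measure"
  by standard

lemma lborel_vec_eq_PiM:
  "(lborel :: (real^'n) measure) = distr (\<Pi>\<^sub>M j\<in>UNIV. lborel) borel vec_lambda"
proof (rule lborel_eqI)
  fix l u :: "real^'n" assume le: "\<And>b. b \<in> Basis \<Longrightarrow> l \<bullet> b \<le> u \<bullet> b"
  have le': "l $ j \<le> u $ j" for j
    using le[of "axis j 1"] by (simp add: cart_eq_inner_axis)
  have "vec_lambda -` box l u \<inter> space (\<Pi>\<^sub>M j\<in>(UNIV::'n set). lborel) = (\<Pi>\<^sub>E j\<in>UNIV. {l $ j<..<u $ j})"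
    by (auto simp: space_PiM mem_box_cart PiE_iff)
  then have "emeasure (distr (\<Pi>\<^sub>M j\<in>UNIV. lborel) borel vec_lambda) (box l u)
     = emeasure (\<Pi>\<^sub>M j\<in>(UNIV::'n set). lborel) (\<Pi>\<^sub>E j\<in>UNIV. {l $ j<..<u $ j})"
    by (simp add: emeasure_distr)
  also have "\<dots> = (\<Prod>j\<in>UNIV. ennreal (u $ j - l $ j))"
    using le' by (subst lborel_product.emeasure_PiM) auto
  also have "\<dots> = ennreal (\<Prod>b\<in>Basis. (u - l) \<bullet> b)"
    using le' by (simp add: prod_Basis_vec prod_ennreal cart_eq_inner_axis[symmetric])
  finally show "emeasure (distr (\<Pi>\<^sub>M j\<in>UNIV. lborel) borel vec_lambda) (box l u) = ennreal (\<Prod>b\<in>Basis. (u - l) \<bullet> b)" .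
qed simp

lemma integral_lborel_vec:
  fixes f :: "real^'n \<Rightarrow> 'a :: {banach, second_countable_topology}"
  assumes "f \<in> borel_measurable borel"
  shows "(LINT x|lborel. f x) = (LINT x|(\<Pi>\<^sub>M j\<in>UNIV. lborel). f (vec_lambda x))"
  unfolding lborel_vec_eq_PiM by (rule integral_distr[OF measurable_vec_lambda assms])

lemma nn_integral_lborel_vec:
  fixes h :: "real^'n \<Rightarrow> ennreal"
  assumes "h \<in> borel_measurable borel"
  shows "(\<integral>\<^sup>+x. h x \<partial>lborel) = (\<integral>\<^sup>+x. h (vec_lambda x) \<partial>(\<Pi>\<^sub>M j\<in>UNIV. lborel))"
  unfolding lborel_vec_eq_PiM by (rule nn_integral_distr[OF measurable_vec_lambda]) (use assms in simp)

lemma linear_borel_measurable: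
  fixes f :: "real^'n \<Rightarrow> real^'n"
  assumes "linear f"
  shows "f \<in> borel_measurable borel"
  by (intro borel_measurable_continuous_onI linear_continuous_on linear_conv_bounded_linear[THEN iffD1] assms)

text \<open>
  With the other coordinates fixed, a shear is a translation of the coordinate \<open>m\<close>, and Fubini's theorem
  allows that coordinate to be integrated first.
\<close>
lemma nn_integral_shear:
  fixes h :: "real^'n \<Rightarrow> ennreal" and m n :: 'n
  assumes [measurable]: "h \<in> borel_measurable borel" and "m \<noteq> n"
  shows "(\<integral>\<^sup>+x. h (\<chi> i. if i = m then x $ m + x $ n else x $ i) \<partial>lborel) = (\<integral>\<^sup>+x. h x \<partial>lborel)"
proof -
  let ?f = "\<lambda>x::real^'n. \<chi> i. if i = m then x $ m + x $ n else x $ i"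
  have "linear ?f"
    by (rule linearI) (auto simp: vec_eq_iff algebra_simps)
  then have [measurable]: "?f \<in> borel_measurable borel" by (rule linear_borel_measurable)
  let ?I = "UNIV - {m}"
  have U: "UNIV = insert m ?I" by auto
  have meas: "(\<lambda>x. g (vec_lambda x)) \<in> borel_measurable (\<Pi>\<^sub>M j\<in>insert m ?I. lborel)" if "g \<in> borel_measurable borel" for g :: "real^'n \<Rightarrow> ennreal"
    using that unfolding U[symmetric] by measurable
  have hf: "(\<lambda>x. h (?f x)) \<in> borel_measurable borel" by measurable
  have "(\<integral>\<^sup>+x. h (?f x) \<partial>lborel) = (\<integral>\<^sup>+x. h (?f (vec_lambda x)) \<partial>(\<Pi>\<^sub>M j\<in>insert m ?I. lborel))"
    unfolding U[symmetric] by (rule nn_integral_lborel_vec[OF hf])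
  also have "\<dots> = (\<integral>\<^sup>+x. \<integral>\<^sup>+y. h (?f (vec_lambda (x(m := y)))) \<partial>lborel \<partial>(\<Pi>\<^sub>M j\<in>?I. lborel))"
    by (rule lborel_product.product_nn_integral_insert[OF _ _ meas[OF hf]]) auto
  also have "\<dots> = (\<integral>\<^sup>+x. \<integral>\<^sup>+y. h (vec_lambda (x(m := y))) \<partial>lborel \<partial>(\<Pi>\<^sub>M j\<in>?I. lborel))"
  proof (rule nn_integral_cong)
    fix x assume x: "x \<in> space (\<Pi>\<^sub>M j\<in>?I. (lborel :: real measure))"
    have "(\<lambda>y. x(m := y)) \<in> lborel \<rightarrow>\<^sub>M (\<Pi>\<^sub>M j\<in>insert m ?I. lborel)"
      using measurable_component_update[OF x, of m] by simp
    from measurable_compose[OF this meas[OF assms(1)]]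
    have [measurable]: "(\<lambda>y. h (vec_lambda (x(m := y)))) \<in> borel_measurable borel" by simp
    have "?f (vec_lambda (x(m := y))) = vec_lambda (x(m := x n + 1 * y))" for y
      using assms(2) by (auto simp: vec_eq_iff)
    then show "(\<integral>\<^sup>+y. h (?f (vec_lambda (x(m := y)))) \<partial>lborel) = (\<integral>\<^sup>+y. h (vec_lambda (x(m := y))) \<partial>lborel)"
      using nn_integral_real_affine[of "\<lambda>y. h (vec_lambda (x(m := y)))" 1 "x n"] by simp
  qed
  also have "\<dots> = (\<integral>\<^sup>+x. h (vec_lambda x) \<partial>(\<Pi>\<^sub>M j\<in>insert m ?I. lborel))"
    by (rule lborel_product.product_nn_integral_insert[OF _ _ meas[OF assms(1)], symmetric]) auto
  also have "\<dots> = (\<integral>\<^sup>+x. h x \<partial>lborel)"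
    unfolding U[symmetric] by (rule nn_integral_lborel_vec[OF assms(1), symmetric])
  finally show ?thesis .
qed

text \<open>
  Both sides are compatible with composition, so elementary linear maps suffice. Stating the
  induction for nonzero determinants makes the degenerate maps among them trivial.
\<close>
lemma nn_integral_linear_change:
  fixes f :: "real^'n \<Rightarrow> real^'n" and h :: "real^'n \<Rightarrow> ennreal"
  assumes "linear f" "det (matrix f) \<noteq> 0" "h \<in> borel_measurable borel"
  shows "(\<integral>\<^sup>+x. h x \<partial>lborel) = ennreal \<bar>det (matrix f)\<bar> * (\<integral>\<^sup>+x. h (f x) \<partial>lborel)"
proof -
  have "det (matrix f) \<noteq> 0 \<longrightarrow> (\<forall>h::real^'n \<Rightarrow> ennreal. h \<in> borel_measurable borel \<longrightarrow>
     (\<integral>\<^sup>+x. h x \<partial>lborel) = ennreal \<bar>det (matrix f)\<bar> * (\<integral>\<^sup>+x. h (f x) \<partial>lborel))" (is "?P f")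
  proof (rule induct_linear_elementary[OF assms(1)], goal_cases)
    case (1 f g)
    show ?case
    proof (intro impI allI)
      fix h :: "real^'n \<Rightarrow> ennreal" assume h [measurable]: "h \<in> borel_measurable borel"
      have [measurable]: "f \<in> borel_measurable borel" using 1 by (intro linear_borel_measurable)
      have eq: "det (matrix (f \<circ> g)) = det (matrix f) * det (matrix g)"
        using 1 by (simp add: matrix_compose det_mul)
      assume "det (matrix (f \<circ> g)) \<noteq> 0"
      then have nz: "det (matrix f) \<noteq> 0" "det (matrix g) \<noteq> 0" using eq by auto
      have hf: "(\<lambda>x. h (f x)) \<in> borel_measurable borel" by measurable
      show "(\<integral>\<^sup>+x. h x \<partial>lborel) = ennreal \<bar>det (matrix (f \<circ> g))\<bar> * (\<integral>\<^sup>+x. h ((f \<circ> g) x) \<partial>lborel)"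
        using 1(3)[rule_format, OF nz(1) h] 1(4)[rule_format, OF nz(2) hf]
        by (simp add: eq abs_mult ennreal_mult mult.assoc)
    qed
  next
    case (2 f i)
    have "row i (matrix f) = 0"
      using 2 by (simp add: row_def matrix_def vec_eq_iff)
    then show ?case using det_zero_row(2) by blast
  next
    case (3 c)
    let ?f = "\<lambda>x::real^'n. \<chi> i. c i * x $ i"
    have "matrix ?f = (\<chi> i j. if i = j then c i else 0)"
      by (simp add: matrix_def vec_eq_iff axis_def)
    then have det: "det (matrix ?f) = (\<Prod>i\<in>UNIV. c i)"
      by (simp add: det_diagonal)
    show ?case
    proof (intro impI allI)
      fix h :: "real^'n \<Rightarrow> ennreal" assume h [measurable]: "h \<in> borel_measurable borel"
      assume "det (matrix ?f) \<noteq> 0"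
      then have nz: "c i \<noteq> 0" for i using det by auto
      let ?c = "\<lambda>b. c (axis_index b)"
      have T: "(\<Sum>b\<in>Basis. (?c b * (x \<bullet> b)) *\<^sub>R b) = ?f x" for x :: "real^'n"
        unfolding Basis_real_vec
        by (subst sum.reindex; simp add: inj_on_def axis_eq_axis axis_index_axis cart_eq_inner_axis[symmetric])
          (simp add: vec_eq_iff axis_def if_distrib cong: if_cong)
      have "linear ?f" by (rule linearI) (auto simp: vec_eq_iff algebra_simps)
      then have [measurable]: "?f \<in> borel_measurable borel" by (rule linear_borel_measurable)
      have "(lborel :: (real^'n) measure) = density (distr lborel borel ?f) (\<lambda>_. ennreal (\<Prod>b\<in>(Basis :: (real^'n) set). \<bar>?c b\<bar>))"
        using lborel_affine_euclidean[of ?c "0::real^'n", OF nz] unfolding T add_0 .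
      also have "(\<Prod>b\<in>(Basis::(real^'n) set). \<bar>?c b\<bar>) = \<bar>det (matrix ?f)\<bar>"
        unfolding det prod_Basis_vec by (simp add: axis_index_axis abs_prod)
      finally have eq: "(lborel :: (real^'n) measure) = density (distr lborel borel ?f) (\<lambda>_. ennreal \<bar>det (matrix ?f)\<bar>)" .
      show "(\<integral>\<^sup>+x. h x \<partial>lborel) = ennreal \<bar>det (matrix ?f)\<bar> * (\<integral>\<^sup>+x. h (?f x) \<partial>lborel)"
        by (subst eq) (simp add: nn_integral_density nn_integral_cmult nn_integral_distr)
    qed
  next
    case (4 m n)
    let ?\<pi> = "Transposition.transpose m n"
    let ?f = "\<lambda>x::real^'n. \<chi> i. x $ ?\<pi> i"
    have lin: "linear ?f" by (rule linearI) (auto simp: vec_eq_iff)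
    then have [measurable]: "?f \<in> borel_measurable borel" by (rule linear_borel_measurable)
    have "matrix ?f = (\<chi> i. mat 1 $ ?\<pi> i)"
      by (auto simp: matrix_def vec_eq_iff axis_def mat_def)
    then have det: "\<bar>det (matrix ?f)\<bar> = 1"
      by (simp add: det_permute_rows permutes_swap_id sign_def)
    have "(lborel :: (real^'n) measure) = distr lborel borel ?f"
    proof (rule lborel_eqI)
      fix l u :: "real^'n" assume le: "\<And>b. b \<in> Basis \<Longrightarrow> l \<bullet> b \<le> u \<bullet> b"
      have le': "l $ j \<le> u $ j" for j
        using le[of "axis j 1"] by (simp add: cart_eq_inner_axis)
      have "?f -` box l u = box (?f l) (?f u)"
        unfolding set_eq_iff vimage_eq mem_box_cart
        by (auto; metis transpose_involutory)
      then have "emeasure (distr lborel borel ?f) (box l u) = emeasure lborel (box (?f l) (?f u))"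
        by (simp add: emeasure_distr)
      also have "\<dots> = ennreal (\<Prod>j\<in>UNIV. (u - l) $ ?\<pi> j)"
      proof (subst emeasure_lborel_box)
        show "?f l \<bullet> b \<le> ?f u \<bullet> b" if "b \<in> Basis" for b
          using that le' by (auto simp: Basis_real_vec cart_eq_inner_axis[symmetric])
      qed (simp add: prod_Basis_vec cart_eq_inner_axis[symmetric])
      also have "(\<Prod>j\<in>UNIV. (u - l) $ ?\<pi> j) = (\<Prod>j\<in>UNIV. (u - l) $ j)"
        by (rule prod.permute[symmetric, unfolded o_def]) (simp add: permutes_swap_id)
      finally show "emeasure (distr lborel borel ?f) (box l u) = ennreal (\<Prod>b\<in>Basis. (u - l) \<bullet> b)"
        by (simp add: prod_Basis_vec cart_eq_inner_axis[symmetric])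
    qed simp
    then have eq: "(lborel :: (real^'n) measure) = distr lborel borel ?f" .
    show ?case
    proof (intro impI allI)
      fix h :: "real^'n \<Rightarrow> ennreal" assume [measurable]: "h \<in> borel_measurable borel"
      show "(\<integral>\<^sup>+x. h x \<partial>lborel) = ennreal \<bar>det (matrix ?f)\<bar> * (\<integral>\<^sup>+x. h (?f x) \<partial>lborel)"
        unfolding det by (subst eq) (simp add: nn_integral_distr)
    qed
  next
    case (5 m n)
    let ?f = "\<lambda>x::real^'n. \<chi> i. if i = m then x $ m + x $ n else x $ i"
    have "matrix ?f = (\<chi> i. if i = m then row m (mat 1) + 1 *s row n (mat 1) else row i (mat 1))"
      using 5 by (auto simp: matrix_def vec_eq_iff axis_def mat_def row_def)
    then have "det (matrix ?f) = 1"
      using det_row_operation[OF 5, of "mat 1 :: real^'n^'n" 1] by simp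
    then show ?case using nn_integral_shear[OF _ 5] by simp
  qed
  with assms show ?thesis by blast
qed

lemma integral_linear_change:
  fixes Q :: "real^'n^'n" and f :: "real^'n \<Rightarrow> complex"
  assumes "det Q \<noteq> 0" and [measurable]: "f \<in> borel_measurable borel"
  shows "(LINT x|lborel. f x) = \<bar>det Q\<bar> *\<^sub>R (LINT x|lborel. f (Q *v x))"
proof -
  have lin: "linear ((*v) Q)" by simp
  then have [measurable]: "(*v) Q \<in> borel_measurable borel" by (rule linear_borel_measurable)
  have "(lborel :: (real^'n) measure) = density (distr lborel borel ((*v) Q)) (\<lambda>_. ennreal \<bar>det Q\<bar>)" (is "_ = ?D")
  proof (rule measure_eqI)
    fix X :: "(real^'n) set" assume "X \<in> sets lborel"
    then have X[measurable]: "X \<in> sets borel" by simp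
    have "emeasure lborel X = (\<integral>\<^sup>+x. indicator X x \<partial>lborel)" by simp
    also have "\<dots> = ennreal \<bar>det Q\<bar> * (\<integral>\<^sup>+x. indicator X (Q *v x) \<partial>lborel)"
      using nn_integral_linear_change[OF lin, of "indicator X"] assms(1) by simp
    also have "\<dots> = emeasure ?D X"
      by (subst nn_integral_indicator[symmetric])
        (simp_all add: nn_integral_density nn_integral_cmult nn_integral_distr del: nn_integral_indicator)
    finally show "emeasure lborel X = emeasure ?D X" .
  qed simp
  then have "(LINT x|lborel. f x) = (LINT x|?D. f x)" by simp
  also have "\<dots> = \<bar>det Q\<bar> *\<^sub>R (LINT x|lborel. f (Q *v x))"
    by (simp add: integral_density integral_distr)
  finally show ?thesis .
qed

section \<open>Products of counting measures\<close>

text \<open>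
  This makes a sum over a product of countable sets an integral over a product measure, on the same
  footing as integrals over lines.
\<close>
lemma PiM_count_space:
  assumes "finite I" "\<And>i. i \<in> I \<Longrightarrow> countable (C i)"
  shows "(\<Pi>\<^sub>M i\<in>I. count_space (C i)) = count_space (\<Pi>\<^sub>E i\<in>I. C i)"
proof -
  define D where "D i = (if i \<in> I then C i else {})" for i
  have "countable (D i)" for i using assms by (auto simp: D_def)
  then interpret product_sigma_finite "\<lambda>i. count_space (D i)"
    by (intro product_sigma_finite.intro sigma_finite_measure_count_space_countable)
  have fin: "finite I" by fact
  have sing: "{x} \<in> sets (\<Pi>\<^sub>M i\<in>I. count_space (D i))" if "x \<in> (\<Pi>\<^sub>E i\<in>I. D i)" for x
  proof -
    have "{x} = (\<Pi>\<^sub>E i\<in>I. {x i})"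
      using that by (auto simp: PiE_iff extensional_def fun_eq_iff) metis
    also have "\<dots> \<in> sets (\<Pi>\<^sub>M i\<in>I. count_space (D i))"
      using that by (intro sets_PiM_I_finite fin) auto
    finally show ?thesis .
  qed
  have cnt: "countable (\<Pi>\<^sub>E i\<in>I. D i)"
    using assms by (intro countable_PiE) (auto simp: D_def)
  have sets: "sets (\<Pi>\<^sub>M i\<in>I. count_space (D i)) = Pow (\<Pi>\<^sub>E i\<in>I. D i)"
  proof
    show "sets (\<Pi>\<^sub>M i\<in>I. count_space (D i)) \<subseteq> Pow (\<Pi>\<^sub>E i\<in>I. D i)"
      using sets.sets_into_space by (fastforce simp: space_PiM)
    show "Pow (\<Pi>\<^sub>E i\<in>I. D i) \<subseteq> sets (\<Pi>\<^sub>M i\<in>I. count_space (D i))"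
    proof
      fix X assume "X \<in> Pow (\<Pi>\<^sub>E i\<in>I. D i)"
      moreover then have "countable X" using cnt countable_subset by blast
      moreover have "X = (\<Union>x\<in>X. {x})" by auto
      ultimately show "X \<in> sets (\<Pi>\<^sub>M i\<in>I. count_space (D i))"
        using sing by (metis (no_types, lifting) PowD sets.countable_UN'' subsetD)
    qed
  qed
  have "count_space (\<Pi>\<^sub>E i\<in>I. D i) = (\<Pi>\<^sub>M i\<in>I. count_space (D i))"
  proof (rule PiM_eqI)
    fix A assume A: "\<And>i. i \<in> I \<Longrightarrow> A i \<in> sets (count_space (D i))"
    then have sub: "(\<Pi>\<^sub>E i\<in>I. A i) \<subseteq> (\<Pi>\<^sub>E i\<in>I. D i)" by (auto simp: PiE_iff)
    show "emeasure (count_space (\<Pi>\<^sub>E i\<in>I. D i)) (Pi\<^sub>E I A) = (\<Prod>i\<in>I. emeasure (count_space (D i)) (A i))"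
    proof (cases "\<exists>i\<in>I. A i = {}")
      case True
      then have "Pi\<^sub>E I A = {}" by (auto simp: PiE_eq_empty_iff)
      moreover have "(\<Prod>i\<in>I. emeasure (count_space (D i)) (A i)) = 0"
      proof -
        obtain i where "i \<in> I" "A i = {}" using True by auto
        then show ?thesis by (intro prod_zero[OF fin] bexI[of _ i]) auto
      qed
      ultimately show ?thesis by simp
    next
      case ne: False
      show ?thesis
      proof (cases "\<forall>i\<in>I. finite (A i)")
        case True
        then have "finite (Pi\<^sub>E I A)" using fin by (intro finite_PiE) auto
        then have "emeasure (count_space (\<Pi>\<^sub>E i\<in>I. D i)) (Pi\<^sub>E I A) = of_nat (card (Pi\<^sub>E I A))"
          using sub by (intro emeasure_count_space_finite)
        also have "\<dots> = (\<Prod>i\<in>I. of_nat (card (A i)))"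
          using fin by (simp add: card_PiE)
        also have "\<dots> = (\<Prod>i\<in>I. emeasure (count_space (D i)) (A i))"
          using A True by (intro prod.cong refl) (auto simp: emeasure_count_space_finite)
        finally show ?thesis .
      next
        case False
        then obtain i where i: "i \<in> I" "infinite (A i)" by auto
        have "infinite (Pi\<^sub>E I A)"
          using finite_PiE_iff[of I A] ne i fin by (auto simp: PiE_eq_empty_iff)
        then have "emeasure (count_space (\<Pi>\<^sub>E i\<in>I. D i)) (Pi\<^sub>E I A) = \<infinity>"
          using sub by (intro emeasure_count_space_infinite)
        also have "\<dots> = (\<Prod>i\<in>I. emeasure (count_space (D i)) (A i))"
        proof -
          have "emeasure (count_space (D j)) (A j) \<noteq> 0" if "j \<in> I" for j
            using A[OF that] ne that by (auto simp: emeasure_count_space)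
          moreover have "emeasure (count_space (D i)) (A i) = \<infinity>"
            using A[OF i(1)] i(2) by (auto intro: emeasure_count_space_infinite)
          ultimately have "(\<Prod>i\<in>I. emeasure (count_space (D i)) (A i)) = top"
            unfolding ennreal_prod_eq_top using fin i(1) by auto
          then show ?thesis by simp
        qed
        finally show ?thesis .
      qed
    qed
  qed (use fin sets in auto)
  also have "(\<Pi>\<^sub>M i\<in>I. count_space (D i)) = (\<Pi>\<^sub>M i\<in>I. count_space (C i))"
    by (intro PiM_cong) (auto simp: D_def)
  also have "(\<Pi>\<^sub>E i\<in>I. D i) = (\<Pi>\<^sub>E i\<in>I. C i)" by (intro PiE_cong) (auto simp: D_def)
  finally show ?thesis by simp
qed

text \<open>
  Unconditional and absolute convergence agree for complex series, and in the divergent case both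
  sides are zero by convention.
\<close>
lemma infsum_eq_integral_count_space:
  fixes f :: "'a \<Rightarrow> complex"
  shows "infsum f A = (LINT x|count_space A. f x)"
proof (cases "f summable_on A")
  case True
  then have "Infinite_Sum.abs_summable_on f A"
    by (simp add: summable_on_iff_abs_summable_on_complex)
  then show ?thesis
    using infsetsum_infsum[of f A] abs_summable_equivalent[of f A] by (simp add: infsetsum_def)
next
  case False
  then have "\<not> Infinite_Sum.abs_summable_on f A"
    by (simp add: summable_on_iff_abs_summable_on_complex)
  then have "\<not> integrable (count_space A) f"
    using abs_summable_equivalent[of f A] by (simp add: Infinite_Set_Sum.abs_summable_on_def)
  with False show ?thesis by (simp add: infsum_not_exists not_integrable_integral_eq)
qed

section \<open>Diagonalising the quadratic form\<close>

text \<open>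
  Products with a transposed matrix are kept in the form \<open>M *v x\<close>, so that the associativity laws for
  matrices apply to them.
\<close>
declare transpose_matrix_vector [simp del]

text \<open>
  Gram--Schmidt orthogonalisation for the inner product \<open>(x, A y)\<close>, adding one vector at a time.
\<close>
lemma pos_def_orthonormal_family:
  fixes A :: "real^'n^'n"
  assumes sym: "transpose A = A" and pos: "pos_def A"
  shows "\<exists>p :: 'n \<Rightarrow> real^'n. \<forall>i\<in>S. \<forall>j\<in>S. p i \<bullet> (A *v p j) = (if i = j then 1 else 0)"
  using finite[of S]
proof (induction S rule: finite_induct)
  case empty
  then show ?case by simp
next
  case (insert k S)
  then obtain p :: "'n \<Rightarrow> real^'n" where p: "p i \<bullet> (A *v p j) = (if i = j then 1 else 0)" if "i \<in> S" "j \<in> S" for i j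
    by blast
  have symA: "x \<bullet> (A *v y) = y \<bullet> (A *v x)" for x y
    using dot_lmul_matrix[of x A y] sym by (metis inner_commute vector_transpose_matrix)
  have "card S < CARD('n)"
    using insert by (metis card_seteq finite_class.finite_UNIV insertI1 UNIV_I not_le subset_UNIV)
  have "span (p ` S) \<noteq> UNIV"
  proof
    assume "span (p ` S) = UNIV"
    then have "dim (UNIV :: (real^'n) set) \<le> card (p ` S)"
      using insert by (intro dim_le_card) auto
    also have "\<dots> \<le> card S" using insert by (intro card_image_le)
    finally show False using \<open>card S < _\<close> by simp
  qed
  then obtain x where x: "x \<notin> span (p ` S)" by auto
  define y where "y = x - (\<Sum>i\<in>S. (p i \<bullet> (A *v x)) *\<^sub>R p i)"
  have "y \<noteq> 0"
  proof
    assume "y = 0"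
    then have "x = (\<Sum>i\<in>S. (p i \<bullet> (A *v x)) *\<^sub>R p i)" by (simp add: y_def)
    also have "\<dots> \<in> span (p ` S)" by (intro span_sum span_scale span_base) auto
    finally show False using x by simp
  qed
  then have ypos: "y \<bullet> (A *v y) > 0" using pos by (simp add: pos_def_def)
  have orth: "p j \<bullet> (A *v y) = 0" if "j \<in> S" for j
  proof -
    have "p j \<bullet> (A *v y) = p j \<bullet> (A *v x) - (\<Sum>i\<in>S. (p i \<bullet> (A *v x)) * (p j \<bullet> (A *v p i)))"
      by (simp add: y_def matrix_vector_mult_diff_distrib inner_diff_right linear_sum[OF matrix_vector_mul_linear] inner_sum_right matrix_vector_mult_scaleR)
    also have "(\<Sum>i\<in>S. (p i \<bullet> (A *v x)) * (p j \<bullet> (A *v p i))) = (\<Sum>i\<in>S. if i = j then p i \<bullet> (A *v x) else 0)"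
      using p that by (intro sum.cong) auto
    finally show ?thesis using that insert by simp
  qed
  define p' where "p' = p(k := (1 / sqrt (y \<bullet> (A *v y))) *\<^sub>R y)"
  have "p' i \<bullet> (A *v p' j) = (if i = j then 1 else 0)" if ij: "i \<in> insert k S" "j \<in> insert k S" for i j
  proof -
    consider "i = k" "j = k" | "i = k" "j \<in> S" | "i \<in> S" "j = k" | "i \<in> S" "j \<in> S" using ij by auto
    then show ?thesis
    proof cases
      case 1
      then show ?thesis using ypos by (simp add: p'_def matrix_vector_mult_scaleR)
    next
      case 2
      then show ?thesis using orth[of j] insert symA[of y "p j"] by (auto simp: p'_def)
    next
      case 3
      then show ?thesis using orth[of i] insert by (auto simp: p'_def matrix_vector_mult_scaleR)
    next
      case 4
      then show ?thesis using p[of i j] insert by (auto simp: p'_def)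
    qed
  qed
  then show ?case by blast
qed

lemma pos_def_congruent_identity:
  fixes A :: "real^'n^'n"
  assumes "transpose A = A" "pos_def A"
  obtains P :: "real^'n^'n" where "transpose P ** A ** P = mat 1"
proof -
  obtain p :: "'n \<Rightarrow> real^'n" where p: "p i \<bullet> (A *v p j) = (if i = j then 1 else 0)" for i j
    using pos_def_orthonormal_family[OF assms, of UNIV] by blast
  define P :: "real^'n^'n" where "P = (\<chi> i j. p j $ i)"
  have "(transpose P ** A ** P) $ i $ j = p i \<bullet> (A *v p j)" for i j
    unfolding matrix_mul_assoc[symmetric]
    by (simp add: matrix_matrix_mult_def matrix_vector_mult_def inner_vec_def transpose_def P_def)
  then have "transpose P ** A ** P = mat 1"
    by (simp add: vec_eq_iff mat_def p)
  then show ?thesis by (rule that)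
qed

lemma congruent_identityD:
  fixes A P :: "real^'n^'n"
  assumes P: "transpose P ** A ** P = mat 1"
  shows "matrix_inv A = P ** transpose P" "A ** (P ** transpose P) = mat 1"
    "det P \<noteq> 0" "det A = 1 / (det P)\<^sup>2" "invertible (transpose P)"
proof -
  have "P ** (transpose P ** A) = mat 1" using P matrix_left_right_inverse by blast
  then have 1: "(P ** transpose P) ** A = mat 1" by (simp add: matrix_mul_assoc)
  then show 2: "A ** (P ** transpose P) = mat 1" using matrix_left_right_inverse by blast
  have "A ** matrix_inv A = mat 1 \<and> matrix_inv A ** A = mat 1"
    unfolding matrix_inv_def using 1 2 by (intro someI_ex[of "\<lambda>A'. A ** A' = mat 1 \<and> A' ** A = mat 1"]) blast
  then show "matrix_inv A = P ** transpose P"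
    using 2 by (metis matrix_mul_assoc matrix_mul_lid matrix_mul_rid)
  have "det P * det A * det P = 1"
    using arg_cong[OF P, of det] by (simp add: det_mul)
  then have 3: "det A * (det P)\<^sup>2 = 1" by (simp add: power2_eq_square mult_ac)
  show 4: "det P \<noteq> 0"
  proof
    assume "det P = 0"
    with 3 show False by simp
  qed
  with 3 show "det A = 1 / (det P)\<^sup>2" by (simp add: nonzero_eq_divide_eq)
  from 4 show "invertible (transpose P)" by (simp add: invertible_det_nz)
qed

lemma bilin_commute: "bilin x y = bilin y x"
  by (simp add: bilin_def mult.commute)

lemma bilin_mult_left: "bilin (M *v x) y = bilin x (transpose M *v y)"
proof -
  have "bilin (M *v x) y = (\<Sum>i\<in>UNIV. \<Sum>j\<in>UNIV. x $ j * (M $ i $ j * y $ i))"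
    by (simp add: bilin_def matrix_vector_mult_def sum_distrib_right sum_distrib_left mult_ac)
  also have "\<dots> = (\<Sum>j\<in>UNIV. \<Sum>i\<in>UNIV. x $ j * (M $ i $ j * y $ i))" by (rule sum.swap)
  finally show ?thesis
    by (simp add: bilin_def matrix_vector_mult_def[abs_def] transpose_def sum_distrib_left)
qed

lemma cmat_mult: "cmat (X ** Y) = cmat X ** cmat Y"
  by (simp add: cmat_def matrix_matrix_mult_def vec_eq_iff)

lemma cmat_transpose: "cmat (transpose X) = transpose (cmat X)"
  by (simp add: cmat_def transpose_def vec_eq_iff)

lemma cmat_mat1 [simp]: "cmat (mat 1) = mat 1"
  by (simp add: cmat_def mat_def vec_eq_iff)

lemma cmat_mult_cvec: "cmat X *v cvec x = cvec (X *v x)"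
  by (simp add: cmat_def cvec_def matrix_vector_mult_def vec_eq_iff)

definition gauss :: "real^'n^'n \<Rightarrow> complex^'n \<Rightarrow> complex \<Rightarrow> complex^'n \<Rightarrow> complex" where
  "gauss B u \<tau> z = exp (of_real pi * \<i> * \<tau> * bilin z (cmat B *v z) - 2 * of_real pi * \<i> * bilin u z)"

text \<open>
  The factor of \<open>gauss\<close> that belongs to a single coordinate, once the quadratic form is a sum of squares.
\<close>
definition gauss1 :: "complex \<Rightarrow> complex \<Rightarrow> complex \<Rightarrow> complex" where
  "gauss1 \<tau> c w = exp (of_real pi * \<i> * \<tau> * w\<^sup>2 - 2 * of_real pi * \<i> * c * w)"

text \<open>
  The inverse of \<open>A\<close> is \<open>P\<close> times its transpose, so in the coordinates obtained from \<open>z\<close> by the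
  transpose of \<open>P\<close> its quadratic form is a sum of squares. All analytic properties of \<open>gauss\<close> are
  reduced in this way to one variable.
\<close>
lemma gauss_factor:
  fixes A P :: "real^'n^'n"
  assumes P: "transpose P ** A ** P = mat 1"
  shows "gauss (matrix_inv A) u \<tau> z = (\<Prod>j\<in>UNIV. gauss1 \<tau> ((cmat (transpose P) *v (cmat A *v u)) $ j) ((cmat (transpose P) *v z) $ j))"
proof -
  let ?w = "cmat (transpose P) *v z" and ?c = "cmat (transpose P) *v (cmat A *v u)"
  note D = congruent_identityD[OF P]
  have 1: "bilin z (cmat (matrix_inv A) *v z) = bilin ?w ?w"
    by (simp add: bilin_mult_left D(1) cmat_mult cmat_transpose matrix_vector_mul_assoc)
  have "cmat P ** cmat (transpose P) ** cmat A = mat 1"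
    using D(2) matrix_left_right_inverse[of A "P ** transpose P"] by (metis cmat_mult cmat_mat1)
  then have 2: "bilin u z = bilin ?c ?w"
    by (subst bilin_commute[of ?c], subst bilin_mult_left)
      (simp add: cmat_transpose matrix_vector_mul_assoc matrix_mul_assoc bilin_commute)
  show ?thesis
    unfolding gauss_def gauss1_def 1 2 exp_sum[OF finite, symmetric]
    by (simp add: bilin_def power2_eq_square sum_subtractf sum_distrib_left mult.assoc)
qed

lemma gauss1_eq:
  assumes "\<tau> \<noteq> 0"
  shows "gauss1 \<tau> c w = exp (- (of_real pi * \<i> / \<tau> * c\<^sup>2)) * exp (- (of_real pi * (- \<i> * \<tau>) * (w + (- c / \<tau>))\<^sup>2))"
proof -
  have "of_real pi * \<i> * \<tau> * w\<^sup>2 - 2 * of_real pi * \<i> * c * w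
      = - (of_real pi * \<i> / \<tau> * c\<^sup>2) + - (of_real pi * (- \<i> * \<tau>) * (w + (- c / \<tau>))\<^sup>2)"
    using assms by (simp add: power2_eq_square field_simps)
  then show ?thesis by (simp only: gauss1_def exp_add)
qed

lemma gauss1_integral:
  assumes "Im \<tau> > 0"
  shows "(LINT x|lborel. gauss1 \<tau> c (of_real x + s)) = exp (- (of_real pi * \<i> / \<tau> * c\<^sup>2)) / csqrt (- \<i> * \<tau>)"
proof -
  have nz: "\<tau> \<noteq> 0" using assms by auto
  have *: "(LINT x|lborel. exp (- (of_real pi * (- \<i> * \<tau>) * (of_real x + (s + (- c / \<tau>)))\<^sup>2))) = 1 / csqrt (- \<i> * \<tau>)"
    by (rule gaussian_integral_shifted) (use assms in simp)
  show ?thesis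
    unfolding gauss1_eq[OF nz] add.assoc integral_mult_right_zero * by simp
qed

lemma gauss1_holomorphic: "gauss1 \<tau> c holomorphic_on UNIV"
  unfolding gauss1_def[abs_def] by (intro holomorphic_intros)

lemma gauss1_strip_decay:
  assumes "Im \<tau> > 0"
  shows "strip_decay (gauss1 \<tau> c)"
  unfolding strip_decay_def
proof
  fix Y
  have "\<tau> \<noteq> 0" using assms by auto
  have "strip_decay (\<lambda>w. exp (- (of_real pi * (- \<i> * \<tau>) * (w + (- c / \<tau>))\<^sup>2)))"
    by (rule strip_decay_translate[OF strip_decay_gaussian]) (use assms in simp)
  then obtain C \<delta> where *: "\<delta> > 0"
     "\<And>w. \<bar>Im w\<bar> \<le> Y \<Longrightarrow> norm (exp (- (of_real pi * (- \<i> * \<tau>) * (w + (- c / \<tau>))\<^sup>2))) \<le> C * exp (- \<delta> * (Re w)\<^sup>2)"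
    by (rule strip_decayE) blast
  let ?K = "norm (exp (- (of_real pi * \<i> / \<tau> * c\<^sup>2)))"
  have "norm (gauss1 \<tau> c w) \<le> (?K * C) * exp (- \<delta> * (Re w)\<^sup>2)" if "\<bar>Im w\<bar> \<le> Y" for w
  proof -
    have "norm (gauss1 \<tau> c w) = ?K * norm (exp (- (of_real pi * (- \<i> * \<tau>) * (w + (- c / \<tau>))\<^sup>2)))"
      by (simp only: gauss1_eq[OF \<open>\<tau> \<noteq> 0\<close>] norm_mult)
    also have "\<dots> \<le> ?K * (C * exp (- \<delta> * (Re w)\<^sup>2))"
      by (intro mult_left_mono *(2) that norm_ge_zero)
    finally show ?thesis by (simp only: mult.assoc)
  qed
  with *(1) show "\<exists>C \<delta>. \<delta> > 0 \<and> (\<forall>w. \<bar>Im w\<bar> \<le> Y \<longrightarrow> norm (gauss1 \<tau> c w) \<le> C * exp (- \<delta> * (Re w)\<^sup>2))"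
    by blast
qed

text \<open>
  The bound is a product over the coordinates: this is what reduces integrability over product
  measures to one-dimensional integrability.
\<close>
definition tube_decay :: "(complex^'n \<Rightarrow> complex) \<Rightarrow> bool" where
  "tube_decay F \<longleftrightarrow> (\<forall>Y. \<exists>C \<delta>. \<delta> > 0 \<and> C \<ge> 0 \<and>
     (\<forall>z. (\<forall>j. \<bar>Im (z $ j)\<bar> \<le> Y) \<longrightarrow> norm (F z) \<le> C * (\<Prod>j\<in>UNIV. exp (- \<delta> * (Re (z $ j))\<^sup>2))))"

lemma prod_exp_neg_square: "(\<Prod>j\<in>UNIV. exp (- d * (v $ j)\<^sup>2)) = exp (- d * (norm v)\<^sup>2)" for v :: "real^'n"
proof -
  have "(norm v)\<^sup>2 = (\<Sum>j\<in>UNIV. (v $ j)\<^sup>2)"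
    unfolding power2_norm_eq_inner inner_vec_def by (simp add: power2_eq_square)
  then show ?thesis by (simp add: sum_distrib_left sum_negf flip: exp_sum)
qed

text \<open>
  The linear map of \<open>gauss_factor\<close> is real, so it maps tubes into tubes and acts on real parts
  alone; being invertible it is bounded below, which transfers the decay back to the original
  coordinates.
\<close>
lemma gauss_tube_decay:
  fixes A :: "real^'n^'n"
  assumes "transpose A = A" "pos_def A" "Im \<tau> > 0"
  shows "tube_decay (gauss (matrix_inv A) u \<tau>)"
  unfolding tube_decay_def
proof
  fix Y
  obtain P :: "real^'n^'n" where P: "transpose P ** A ** P = mat 1" using pos_def_congruent_identity[OF assms(1,2)] .
  note D = congruent_identityD[OF P]
  let ?Q = "transpose P"
  let ?c = "\<lambda>j. (cmat ?Q *v (cmat A *v u)) $ j"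
  \<comment> \<open>A tube that contains the image of the tube of width \<open>Y\<close>.\<close>
  define Y' where "Y' = (\<Sum>i\<in>UNIV. \<Sum>j\<in>UNIV. \<bar>?Q $ i $ j\<bar> * \<bar>Y\<bar>)"
  have "\<forall>j. \<exists>C \<delta>. \<delta> > 0 \<and> C \<ge> 0 \<and> (\<forall>w. \<bar>Im w\<bar> \<le> Y' \<longrightarrow> norm (gauss1 \<tau> (?c j) w) \<le> C * exp (- \<delta> * (Re w)\<^sup>2))"
  proof
    fix j
    obtain C \<delta> where "\<delta> > 0" "\<And>w. \<bar>Im w\<bar> \<le> Y' \<Longrightarrow> norm (gauss1 \<tau> (?c j) w) \<le> C * exp (- \<delta> * (Re w)\<^sup>2)" "C \<ge> 0"
      using strip_decayE[OF gauss1_strip_decay[OF assms(3)]] by metis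
    then show "\<exists>C \<delta>. \<delta> > 0 \<and> C \<ge> 0 \<and> (\<forall>w. \<bar>Im w\<bar> \<le> Y' \<longrightarrow> norm (gauss1 \<tau> (?c j) w) \<le> C * exp (- \<delta> * (Re w)\<^sup>2))"
      by blast
  qed
  then obtain C \<delta> where C\<delta>: "\<And>j. \<delta> j > 0" "\<And>j. C j \<ge> 0"
    "\<And>j w. \<bar>Im w\<bar> \<le> Y' \<Longrightarrow> norm (gauss1 \<tau> (?c j) w) \<le> C j * exp (- \<delta> j * (Re w)\<^sup>2)"
    by metis
  define d where "d = Min (range \<delta>)"
  have d: "d > 0" "d \<le> \<delta> j" for j using C\<delta>(1) by (auto simp: d_def)
  obtain b where b: "b > 0" "\<And>x. b * norm x \<le> norm (?Q *v x)"
    using linear_inj_bounded_below_pos[of "(*v) ?Q"] inj_matrix_vector_mult[OF D(5)] by auto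
  have "norm (gauss (matrix_inv A) u \<tau> z) \<le> (\<Prod>j\<in>UNIV. C j) * (\<Prod>j\<in>UNIV. exp (- (d * b\<^sup>2) * (Re (z $ j))\<^sup>2))"
    if z: "\<forall>j. \<bar>Im (z $ j)\<bar> \<le> Y" for z :: "complex^'n"
  proof -
    define x where "x = (\<chi> j. Re (z $ j))"
    let ?w = "cmat ?Q *v z"
    have Re: "Re (?w $ j) = (?Q *v x) $ j" for j
      by (simp add: matrix_vector_mult_def cmat_def x_def)
    have Im: "\<bar>Im (?w $ i)\<bar> \<le> Y'" for i
    proof -
      have "\<bar>Im (?w $ i)\<bar> = abs (\<Sum>j\<in>UNIV. ?Q $ i $ j * Im (z $ j))"
        by (simp add: matrix_vector_mult_def cmat_def)
      also have "\<dots> \<le> (\<Sum>j\<in>UNIV. abs (?Q $ i $ j * Im (z $ j)))" by (rule sum_abs)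
      also have "\<dots> \<le> (\<Sum>j\<in>UNIV. abs (?Q $ i $ j) * abs Y)"
        unfolding abs_mult using z by (intro sum_mono mult_left_mono) (auto intro: order_trans)
      also have "\<dots> \<le> Y'"
        unfolding Y'_def by (rule member_le_sum) (auto intro: sum_nonneg)
      finally show ?thesis .
    qed
    have "norm (gauss (matrix_inv A) u \<tau> z) = (\<Prod>j\<in>UNIV. norm (gauss1 \<tau> (?c j) (?w $ j)))"
      unfolding gauss_factor[OF P] by (simp add: prod_norm)
    also have "\<dots> \<le> (\<Prod>j\<in>UNIV. C j * exp (- d * (Re (?w $ j))\<^sup>2))"
    proof (rule prod_mono, intro conjI norm_ge_zero)
      fix j
      have "norm (gauss1 \<tau> (?c j) (?w $ j)) \<le> C j * exp (- \<delta> j * (Re (?w $ j))\<^sup>2)"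
        by (rule C\<delta>(3)[OF Im])
      also have "\<dots> \<le> C j * exp (- d * (Re (?w $ j))\<^sup>2)"
        using C\<delta>(2)[of j] d by (intro mult_left_mono) (auto intro: mult_right_mono)
      finally show "norm (gauss1 \<tau> (?c j) (?w $ j)) \<le> C j * exp (- d * (Re (?w $ j))\<^sup>2)" .
    qed
    also have "\<dots> = (\<Prod>j\<in>UNIV. C j) * exp (- d * (norm (?Q *v x))\<^sup>2)"
      unfolding prod.distrib Re prod_exp_neg_square ..
    also have "\<dots> \<le> (\<Prod>j\<in>UNIV. C j) * exp (- d * (b * norm x)\<^sup>2)"
      using b d C\<delta>(2) by (intro mult_left_mono prod_nonneg) (auto intro!: mult_left_mono power_mono)
    also have "exp (- d * (b * norm x)\<^sup>2) = (\<Prod>j\<in>UNIV. exp (- (d * b\<^sup>2) * (Re (z $ j))\<^sup>2))"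
      using prod_exp_neg_square[of "d * b\<^sup>2" x] by (simp add: x_def power_mult_distrib mult.assoc)
    finally show ?thesis .
  qed
  then show "\<exists>C \<delta>. \<delta> > 0 \<and> C \<ge> 0 \<and> (\<forall>z. (\<forall>j. \<bar>Im (z $ j)\<bar> \<le> Y) \<longrightarrow>
      norm (gauss (matrix_inv A) u \<tau> z) \<le> C * (\<Prod>j\<in>UNIV. exp (- \<delta> * (Re (z $ j))\<^sup>2)))"
    using b d C\<delta>(2) by (intro exI[of _ "\<Prod>j\<in>UNIV. C j"] exI[of _ "d * b\<^sup>2"]) (auto intro: prod_nonneg)
qed

text \<open>
  The change of variables by the transpose of \<open>P\<close> contributes the determinant, since
  \<open>det A = 1 / (det P)\<^sup>2\<close>, and each of the remaining one-dimensional integrals is independent of the shift.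
\<close>
lemma gauss_integral:
  fixes A :: "real^'n^'n" and s :: "complex^'n"
  assumes "transpose A = A" "pos_def A" "Im \<tau> > 0"
  shows "(LINT x|lborel. gauss (matrix_inv A) u \<tau> (cvec x + s))
    = csqrt (of_real (det A)) / csqrt (- \<i> * \<tau>) ^ CARD('n) * exp (- (of_real pi * \<i> / \<tau> * bilin u (cmat A *v u)))"
proof -
  obtain P :: "real^'n^'n" where P: "transpose P ** A ** P = mat 1" using pos_def_congruent_identity[OF assms(1,2)] .
  note D = congruent_identityD[OF P]
  let ?Q = "transpose P"
  let ?c = "cmat ?Q *v (cmat A *v u)"
  let ?s = "cmat ?Q *v s"
  let ?g = "\<lambda>y::real^'n. \<Prod>j\<in>UNIV. gauss1 \<tau> (?c $ j) (of_real (y $ j) + ?s $ j)"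
  have g1m [measurable]: "gauss1 \<tau> c \<in> borel_measurable borel" for c
    unfolding gauss1_def[abs_def] by measurable
  have gm: "?g \<in> borel_measurable borel" by measurable
  have "(LINT x|lborel. gauss (matrix_inv A) u \<tau> (cvec x + s)) = (LINT x|lborel. ?g (?Q *v x))"
    unfolding gauss_factor[OF P]
    by (intro Bochner_Integration.integral_cong refl prod.cong)
      (simp only: matrix_vector_right_distrib cmat_mult_cvec, simp add: cvec_def)
  also have "\<dots> = (1 / \<bar>det ?Q\<bar>) *\<^sub>R (LINT y|lborel. ?g y)"
    using integral_linear_change[OF _ gm, of ?Q] D(3) by simp
  also have "(LINT y|lborel. ?g y) = (LINT y|(\<Pi>\<^sub>M j\<in>(UNIV::'n set). lborel). (\<Prod>j\<in>UNIV. gauss1 \<tau> (?c $ j) (of_real (y j) + ?s $ j)))"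
    by (subst integral_lborel_vec[OF gm]) simp
  also have "\<dots> = (\<Prod>j\<in>UNIV. (LINT y|lborel. gauss1 \<tau> (?c $ j) (of_real y + ?s $ j)))"
  proof (rule lborel_product.product_integral_prod)
    fix j :: 'n
    show "integrable lborel (\<lambda>y. gauss1 \<tau> (?c $ j) (of_real y + ?s $ j))"
      using strip_decay_integrable_line[OF gauss1_holomorphic gauss1_strip_decay[OF assms(3)], of "\<lambda>_. 1" 1 "?c $ j" "?s $ j"] by simp
  qed simp
  also have "\<dots> = (\<Prod>j\<in>UNIV. exp (- (of_real pi * \<i> / \<tau> * (?c $ j)\<^sup>2)) / csqrt (- \<i> * \<tau>))"
    by (simp only: gauss1_integral[OF assms(3)])
  also have "\<dots> = exp (- (of_real pi * \<i> / \<tau> * bilin ?c ?c)) / csqrt (- \<i> * \<tau>) ^ CARD('n)"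
    by (simp add: prod_dividef bilin_def power2_eq_square sum_distrib_left sum_negf flip: exp_sum)
  also have "bilin ?c ?c = bilin u (cmat A *v u)"
  proof -
    have "bilin ?c ?c = bilin (cmat A *v u) (cmat (P ** transpose P ** A) *v u)"
      by (subst bilin_mult_left) (simp add: cmat_transpose cmat_mult matrix_vector_mul_assoc matrix_mul_assoc)
    also have "P ** transpose P ** A = mat 1"
      using D(2) matrix_left_right_inverse by blast
    finally show ?thesis by (simp add: bilin_commute)
  qed
  also have "1 / \<bar>det ?Q\<bar> = sqrt (det A)"
    using D(3,4) by (simp add: real_sqrt_divide)
  finally show ?thesis
    using D(4) by (simp add: scaleR_conv_of_real)
qed

section \<open>Integrals over products of contours\<close>

text \<open>
  The three sets over which a coordinate may range: a line above the poles, the real axis, and the set of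
  poles. A point is the sum of a real parameter and a complex shift. Letting the
  integer parameters of \<open>Poles\<close> be real numbers gives all coordinates the same type, so that
  mixtures of the three are ordinary product measures. The weight of a pole is its sign
  \<open>(- 1)\<^sup>x = cos (\<pi> x)\<close>.
\<close>
datatype contour = Raised | Real_axis | Poles

fun contour_measure :: "contour \<Rightarrow> real measure" where
  "contour_measure Poles = count_space \<int>"
| "contour_measure _ = lborel"

fun contour_shift :: "complex \<Rightarrow> contour \<Rightarrow> complex" where
  "contour_shift e Raised = \<i> * of_real (raised e)"
| "contour_shift e Real_axis = 0"
| "contour_shift e Poles = \<i> * e"

fun contour_weight :: "complex \<Rightarrow> contour \<Rightarrow> real \<Rightarrow> complex" where
  "contour_weight e Poles x = of_real (cos (pi * x))"
| "contour_weight e t x = kern (of_real x + contour_shift e t - \<i> * e)"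

lemma sigma_finite_contour_measure: "sigma_finite_measure (contour_measure t)"
proof (cases t)
  case Poles
  have "countable (\<int> :: real set)" unfolding Ints_def by simp
  with Poles show ?thesis by (simp add: sigma_finite_measure_count_space_countable)
qed (auto intro: sigma_finite_lborel)

interpretation contour_product: product_sigma_finite "\<lambda>j. contour_measure (\<sigma> j)" for \<sigma> :: "'i \<Rightarrow> contour"
  by (intro product_sigma_finite.intro sigma_finite_contour_measure)

lemma integrable_dominated:
  fixes f :: "'a \<Rightarrow> 'b :: {banach, second_countable_topology}" and g :: "'a \<Rightarrow> real"
  assumes "integrable M g" "f \<in> borel_measurable M" "\<And>x. norm (f x) \<le> g x"
  shows "integrable M f"
proof (rule Bochner_Integration.integrable_bound[OF assms(1,2)], rule AE_I2)
  show "norm (f x) \<le> norm (g x)" for x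
    using assms(3)[of x] abs_ge_self[of "g x"] by (simp only: real_norm_def)
qed

lemma measurable_contour_measure:
  "f \<in> borel_measurable borel \<Longrightarrow> f \<in> borel_measurable (contour_measure t)"
  by (cases t) auto

lemma borel_measurable_contour_weight: "contour_weight e t \<in> borel_measurable borel"
proof (cases t)
  case Poles
  then have "contour_weight e t = (\<lambda>x. of_real (cos (pi * x)))" by (simp add: fun_eq_iff)
  then show ?thesis by simp
next
  case Raised
  then have "contour_weight e t = (\<lambda>x. kern (of_real x + contour_shift e t - \<i> * e))" by (simp add: fun_eq_iff)
  then show ?thesis by simp
next
  case Real_axis
  then have "contour_weight e t = (\<lambda>x. kern (of_real x + contour_shift e t - \<i> * e))" by (simp add: fun_eq_iff)
  then show ?thesis by simp
qed

lemma measurable_contour_weight: "contour_weight e t \<in> borel_measurable (contour_measure t')"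
  by (rule measurable_contour_measure[OF borel_measurable_contour_weight])

lemma contour_weight_bounded:
  assumes "Re e \<noteq> 0"
  obtains M where "\<And>x. norm (contour_weight e t x) \<le> M"
proof (cases t)
  case Poles
  then show ?thesis using that[of 1] by simp
next
  case Raised
  have "Im (of_real x + contour_shift e t - \<i> * e) = raised e - Re e" for x by (simp add: Raised)
  moreover have "raised e - Re e \<noteq> 0" using assms by (simp add: raised_def)
  ultimately have "norm (contour_weight e t x) \<le> 1 / (2 * \<bar>sinh (pi * (raised e - Re e))\<bar>)" for x
    using norm_kern_le[of "of_real x + contour_shift e t - \<i> * e"] Raised by simp
  then show ?thesis by (rule that)
next
  case Real_axis
  have "norm (contour_weight e t x) \<le> 1 / (2 * \<bar>sinh (pi * (- Re e))\<bar>)" for x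
    using norm_kern_le[of "of_real x + contour_shift e t - \<i> * e"] Real_axis assms by simp
  then show ?thesis by (rule that)
qed

lemma contour_gaussian_integrable:
  assumes "\<delta> > 0" "Re e \<noteq> 0"
  shows "integrable (contour_measure t)
    (\<lambda>x. exp (- \<delta> * (Re (of_real x + contour_shift e t))\<^sup>2) * norm (contour_weight e t x))"
proof -
  obtain M where M: "\<And>x. norm (contour_weight e t x) \<le> M" using contour_weight_bounded[OF assms(2), of t] by blast
  have "integrable (contour_measure t) (\<lambda>x. exp (- \<delta> * (x + Re (contour_shift e t))\<^sup>2))"
    using gaussian_integrable[OF assms(1), of "Re (contour_shift e t)"]
      gaussian_summable_Ints[OF assms(1), of "Re (contour_shift e t)"] by (cases t) simp_all
  then have "integrable (contour_measure t) (\<lambda>x. exp (- \<delta> * (x + Re (contour_shift e t))\<^sup>2) * M)" by simp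
  then show ?thesis
  proof (rule integrable_dominated)
    have "(\<lambda>x. exp (- \<delta> * (Re (of_real x + contour_shift e t))\<^sup>2)) \<in> borel_measurable borel" by measurable
    then show "(\<lambda>x. exp (- \<delta> * (Re (of_real x + contour_shift e t))\<^sup>2) * norm (contour_weight e t x)) \<in> borel_measurable (contour_measure t)"
      by (intro borel_measurable_times measurable_compose[OF measurable_contour_weight borel_measurable_norm])
        (rule measurable_contour_measure)
    show "norm (exp (- \<delta> * (Re (of_real x + contour_shift e t))\<^sup>2) * norm (contour_weight e t x))
      \<le> exp (- \<delta> * (x + Re (contour_shift e t))\<^sup>2) * M" for x
      using M[of x] by (simp add: mult_left_mono)
  qed
qed

lemma borel_measurable_vec_lambda:
  fixes f :: "'a \<Rightarrow> 'n::finite \<Rightarrow> complex"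
  assumes "\<And>j. (\<lambda>x. f x j) \<in> borel_measurable M"
  shows "(\<lambda>x. \<chi> j. f x j) \<in> borel_measurable M"
proof (subst borel_measurable_euclidean_space, rule ballI)
  fix b :: "complex^'n" assume "b \<in> Basis"
  then obtain j c where "b = axis j c" by (auto simp: Basis_vec_def)
  then have "(\<lambda>x. (\<chi> j. f x j) \<bullet> b) = (\<lambda>x. f x j \<bullet> c)" by (simp add: inner_axis)
  then show "(\<lambda>x. (\<chi> j. f x j) \<bullet> b) \<in> borel_measurable M"
    using assms[of j] by simp
qed

text \<open>
  The integrability that goes with \<open>product_integral_insert\<close>; it is needed to add iterated integrals.
\<close>
lemma (in product_sigma_finite) product_integrable_insert:
  fixes f :: "_ \<Rightarrow> _::{banach, second_countable_topology}"
  assumes I: "finite I" "i \<notin> I" and f: "integrable (Pi\<^sub>M (insert i I) M) f"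
  shows "integrable (Pi\<^sub>M I M) (\<lambda>x. \<integral>y. f (x(i:=y)) \<partial>M i)"
proof -
  interpret I: finite_product_sigma_finite M I by standard fact
  interpret J: finite_product_sigma_finite M "{i}" by standard simp
  interpret P: pair_sigma_finite "Pi\<^sub>M I M" "Pi\<^sub>M {i} M" ..
  have f_borel: "f \<in> borel_measurable (Pi\<^sub>M (insert i I) M)" using f by auto
  have "integrable (distr (Pi\<^sub>M I M \<Otimes>\<^sub>M Pi\<^sub>M {i} M) (Pi\<^sub>M (I \<union> {i}) M) (merge I {i})) f"
    using f I by (subst distr_merge) auto
  then have "integrable (Pi\<^sub>M I M \<Otimes>\<^sub>M Pi\<^sub>M {i} M) (\<lambda>x. f (merge I {i} x))"
    by (subst (asm) integrable_distr_eq) (use f_borel measurable_merge[of I "{i}" M] in auto)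
  from P.integrable_fst'[OF this]
  have "integrable (Pi\<^sub>M I M) (\<lambda>x. \<integral>y. f (merge I {i} (x, y)) \<partial>Pi\<^sub>M {i} M)" by simp
  moreover have "(\<integral>y. f (merge I {i} (x, y)) \<partial>Pi\<^sub>M {i} M) = (\<integral>y. f (x(i:=y)) \<partial>M i)"
    if x: "x \<in> space (Pi\<^sub>M I M)" for x
  proof -
    have "(\<lambda>y. f (x(i := y))) \<in> borel_measurable (M i)"
      using measurable_comp[OF measurable_component_update f_borel, OF x \<open>i \<notin> I\<close>] unfolding comp_def .
    then have "(\<integral>y. f (x(i:=y)) \<partial>M i) = (\<integral>y. f (x(i := y i)) \<partial>Pi\<^sub>M {i} M)"
      by (rule product_integral_singleton[symmetric])
    also have "\<dots> = (\<integral>y. f (merge I {i} (x, y)) \<partial>Pi\<^sub>M {i} M)"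
      using x I by (auto intro!: Bochner_Integration.integral_cong arg_cong[where f=f] simp: merge_def space_PiM extensional_def PiE_def)
    finally show ?thesis ..
  qed
  ultimately show ?thesis by (simp cong: Bochner_Integration.integrable_cong)
qed

text \<open>
  Moving the contour of one coordinate needs an integrand that is entire in that coordinate with the
  others fixed; joint continuity serves measurability.
\<close>
locale tube_entire =
  fixes F :: "complex^'n \<Rightarrow> complex"
  assumes cont: "continuous_on UNIV F"
    and holo: "\<And>z j. (\<lambda>w. F (\<chi> i. if i = j then w else z i)) holomorphic_on UNIV"
    and decay: "tube_decay F"
begin

definition contour_point :: "complex^'n \<Rightarrow> ('n \<Rightarrow> contour) \<Rightarrow> ('n \<Rightarrow> real) \<Rightarrow> complex^'n" where
  "contour_point \<epsilon> \<sigma> x = (\<chi> j. of_real (x j) + contour_shift (\<epsilon> $ j) (\<sigma> j))"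

definition contour_integrand :: "complex^'n \<Rightarrow> ('n \<Rightarrow> contour) \<Rightarrow> ('n \<Rightarrow> real) \<Rightarrow> complex" where
  "contour_integrand \<epsilon> \<sigma> x = F (contour_point \<epsilon> \<sigma> x) * (\<Prod>j\<in>UNIV. contour_weight (\<epsilon> $ j) (\<sigma> j) (x j))"

definition multi_integral :: "complex^'n \<Rightarrow> ('n \<Rightarrow> contour) \<Rightarrow> complex" where
  "multi_integral \<epsilon> \<sigma> = (LINT x|(\<Pi>\<^sub>M j\<in>UNIV. contour_measure (\<sigma> j)). contour_integrand \<epsilon> \<sigma> x)"

lemma slice_strip_decay: "strip_decay (\<lambda>w. F (\<chi> i. if i = j then w else z i))"
  unfolding strip_decay_def
proof
  fix Y
  define Y' where "Y' = \<bar>Y\<bar> + (\<Sum>i\<in>UNIV. \<bar>Im (z i)\<bar>)"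
  obtain C \<delta> where C: "\<delta> > 0" "C \<ge> 0"
    "\<And>z. (\<And>j. \<bar>Im (z $ j)\<bar> \<le> Y') \<Longrightarrow> norm (F z) \<le> C * (\<Prod>j\<in>UNIV. exp (- \<delta> * (Re (z $ j))\<^sup>2))"
    using decay unfolding tube_decay_def by meson
  have "norm (F (\<chi> i. if i = j then w else z i)) \<le> C * exp (- \<delta> * (Re w)\<^sup>2)" if "\<bar>Im w\<bar> \<le> Y" for w
  proof -
    let ?z = "\<chi> i. if i = j then w else z i"
    have sum: "\<bar>Im (z i)\<bar> \<le> (\<Sum>i\<in>UNIV. \<bar>Im (z i)\<bar>)" for i by (rule member_le_sum) auto
    have "\<bar>Im w\<bar> \<le> Y'" "\<bar>Im (z i)\<bar> \<le> Y'" for i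
      unfolding Y'_def using that sum[of i] by linarith+
    then have "\<bar>Im (?z $ i)\<bar> \<le> Y'" for i by simp
    then have "norm (F ?z) \<le> C * (\<Prod>i\<in>UNIV. exp (- \<delta> * (Re (?z $ i))\<^sup>2))" by (rule C(3))
    also have "(\<Prod>i\<in>UNIV. exp (- \<delta> * (Re (?z $ i))\<^sup>2)) = exp (- \<delta> * (Re w)\<^sup>2) * (\<Prod>i\<in>UNIV - {j}. exp (- \<delta> * (Re (?z $ i))\<^sup>2))"
      by (subst prod.remove[of UNIV j]) auto
    also have "\<dots> \<le> exp (- \<delta> * (Re w)\<^sup>2) * 1"
      using C(1) by (intro mult_left_mono prod_le_1) auto
    finally show ?thesis using C(2) by (simp add: mult_left_mono)
  qed
  with C(1) show "\<exists>C \<delta>. \<delta> > 0 \<and> (\<forall>w. \<bar>Im w\<bar> \<le> Y \<longrightarrow> norm (F (\<chi> i. if i = j then w else z i)) \<le> C * exp (- \<delta> * (Re w)\<^sup>2))"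
    by blast
qed

lemma measurable_F: "F \<in> borel_measurable borel"
  using cont by (rule borel_measurable_continuous_onI)

text \<open>
  The imaginary parts of the shifts are fixed, hence the integrand stays in one tube and is dominated
  by a product of one-dimensional Gaussians with weights.
\<close>
lemma weighted_integrable:
  assumes \<kappa>: "\<And>j. \<kappa> j \<in> borel_measurable borel"
    and int: "\<And>\<delta> j. \<delta> > 0 \<Longrightarrow>
      integrable (contour_measure (\<sigma> j)) (\<lambda>x. exp (- \<delta> * (Re (of_real x + s j))\<^sup>2) * norm (\<kappa> j x))"
  shows "integrable (\<Pi>\<^sub>M j\<in>UNIV. contour_measure (\<sigma> j)) (\<lambda>x. F (\<chi> j. of_real (x j) + s j) * (\<Prod>j\<in>UNIV. \<kappa> j (x j)))"
    (is "integrable ?M ?f")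
proof -
  define Y where "Y = (\<Sum>j\<in>UNIV. \<bar>Im (s j)\<bar>)"
  obtain C \<delta> where C: "\<delta> > 0" "C \<ge> 0"
    "\<And>z. (\<And>j. \<bar>Im (z $ j)\<bar> \<le> Y) \<Longrightarrow> norm (F z) \<le> C * (\<Prod>j\<in>UNIV. exp (- \<delta> * (Re (z $ j))\<^sup>2))"
    using decay unfolding tube_decay_def by meson
  let ?g = "\<lambda>j x. exp (- \<delta> * (Re (of_real x + s j))\<^sup>2) * norm (\<kappa> j x)"
  have "integrable ?M (\<lambda>x. C * (\<Prod>j\<in>UNIV. ?g j (x j)))"
    by (intro integrable_mult_right contour_product.product_integrable_prod int C) auto
  then show ?thesis
  proof (rule integrable_dominated)
    have component: "(\<lambda>x. g (x j)) \<in> borel_measurable ?M" if "g \<in> borel_measurable borel" for g :: "real \<Rightarrow> complex" and j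
      by (rule measurable_compose[OF measurable_component_singleton[of j]])
        (auto intro!: measurable_contour_measure that)
    have "(\<lambda>x. \<chi> j. of_real (x j) + s j) \<in> borel_measurable ?M"
      by (intro borel_measurable_vec_lambda component) measurable
    then show "?f \<in> borel_measurable ?M"
      by (intro borel_measurable_times measurable_compose[OF _ measurable_F] borel_measurable_prod component \<kappa>)
    show "norm (?f x) \<le> C * (\<Prod>j\<in>UNIV. ?g j (x j))" for x
    proof -
      let ?z = "\<chi> j. of_real (x j) + s j"
      have "\<bar>Im (?z $ j)\<bar> \<le> Y" for j
        unfolding Y_def using member_le_sum[of j UNIV "\<lambda>j. \<bar>Im (s j)\<bar>"] by simp
      then have "norm (F ?z) \<le> C * (\<Prod>j\<in>UNIV. exp (- \<delta> * (Re (?z $ j))\<^sup>2))"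
        by (rule C(3))
      then have "norm (?f x) \<le> (C * (\<Prod>j\<in>UNIV. exp (- \<delta> * (Re (?z $ j))\<^sup>2))) * (\<Prod>j\<in>UNIV. norm (\<kappa> j (x j)))"
        unfolding norm_mult prod_norm[symmetric]
        by (intro mult_right_mono prod_nonneg) auto
      also have "\<dots> = C * (\<Prod>j\<in>UNIV. ?g j (x j))"
        by (simp add: prod.distrib mult.assoc)
      finally show ?thesis .
    qed
  qed
qed

lemma contour_integrand_integrable:
  fixes \<epsilon> :: "complex^'n"
  assumes "\<And>j. Re (\<epsilon> $ j) \<noteq> 0"
  shows "integrable (\<Pi>\<^sub>M j\<in>UNIV. contour_measure (\<sigma> j)) (contour_integrand \<epsilon> \<sigma>)"
  unfolding contour_integrand_def[abs_def] contour_point_def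
  by (intro weighted_integrable borel_measurable_contour_weight contour_gaussian_integrable assms)

text \<open>
  Fubini's theorem isolates the coordinate \<open>j\<close>, and \<open>contour_step\<close> applies to the inner integral with
  the other coordinates fixed.
\<close>
lemma multi_integral_step:
  fixes \<epsilon> :: "complex^'n"
  assumes \<epsilon>: "\<And>j. Re (\<epsilon> $ j) \<noteq> 0" and j: "\<sigma> j = Raised"
  shows "multi_integral \<epsilon> \<sigma> = multi_integral \<epsilon> (\<sigma>(j := Real_axis))
     + of_real ((1 + sgn (Re (\<epsilon> $ j))) / 2) * multi_integral \<epsilon> (\<sigma>(j := Poles))"
proof -
  let ?I = "UNIV - {j}"
  let ?M = "\<Pi>\<^sub>M i\<in>?I. contour_measure (\<sigma> i)"
  let ?h = "of_real ((1 + sgn (Re (\<epsilon> $ j))) / 2) :: complex"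
  define z where "z x i = of_real (x i) + contour_shift (\<epsilon> $ i) (\<sigma> i)" for x i
  define f where "f x w = F (\<chi> i. if i = j then w else z x i)" for x w
  define W where "W x = (\<Prod>i\<in>?I. contour_weight (\<epsilon> $ i) (\<sigma> i) (x i))" for x
  define inner where "inner t x = W x * (LINT y|contour_measure t. f x (of_real y + contour_shift (\<epsilon> $ j) t) * contour_weight (\<epsilon> $ j) t y)" for t x
  have U: "UNIV = insert j ?I" by auto
  have split: "contour_integrand \<epsilon> (\<sigma>(j := t)) (x(j := y)) = W x * (f x (of_real y + contour_shift (\<epsilon> $ j) t) * contour_weight (\<epsilon> $ j) t y)" for t x y
  proof -
    have "contour_point \<epsilon> (\<sigma>(j := t)) (x(j := y)) = (\<chi> i. if i = j then of_real y + contour_shift (\<epsilon> $ j) t else z x i)"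
      by (auto simp: contour_point_def z_def vec_eq_iff)
    moreover have "(\<Prod>i\<in>UNIV. contour_weight (\<epsilon> $ i) ((\<sigma>(j := t)) i) ((x(j := y)) i)) = contour_weight (\<epsilon> $ j) t y * W x"
      unfolding W_def by (subst prod.remove[of UNIV j]) (auto intro!: prod.cong)
    ultimately show ?thesis by (simp add: contour_integrand_def f_def)
  qed
  have M: "(\<Pi>\<^sub>M i\<in>?I. contour_measure ((\<sigma>(j := t)) i)) = ?M" for t by (rule PiM_cong) auto
  have int: "integrable (\<Pi>\<^sub>M i\<in>insert j ?I. contour_measure ((\<sigma>(j := t)) i)) (contour_integrand \<epsilon> (\<sigma>(j := t)))" for t
    unfolding U[symmetric] by (rule contour_integrand_integrable[OF \<epsilon>])
  have integrable_inner: "integrable ?M (inner t)" for t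
    using contour_product.product_integrable_insert[OF _ _ int[of t]] unfolding split M inner_def by simp
  have multi: "multi_integral \<epsilon> (\<sigma>(j := t)) = (LINT x|?M. inner t x)" for t
  proof -
    have "multi_integral \<epsilon> (\<sigma>(j := t)) = (LINT x|(\<Pi>\<^sub>M i\<in>insert j ?I. contour_measure ((\<sigma>(j := t)) i)). contour_integrand \<epsilon> (\<sigma>(j := t)) x)"
      unfolding multi_integral_def U[symmetric] ..
    also have "\<dots> = (LINT x|(\<Pi>\<^sub>M i\<in>?I. contour_measure ((\<sigma>(j := t)) i)). (LINT y|contour_measure ((\<sigma>(j := t)) j). contour_integrand \<epsilon> (\<sigma>(j := t)) (x(j := y))))"
      by (rule contour_product.product_integral_insert[OF _ _ int]) auto
    finally show ?thesis unfolding split M inner_def by simp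
  qed
  have "inner Raised x = inner Real_axis x + ?h * inner Poles x" for x
  proof -
    have "(LINT y|contour_measure Raised. f x (of_real y + contour_shift (\<epsilon> $ j) Raised) * contour_weight (\<epsilon> $ j) Raised y)
      = (LINT y|contour_measure Real_axis. f x (of_real y + contour_shift (\<epsilon> $ j) Real_axis) * contour_weight (\<epsilon> $ j) Real_axis y)
      + ?h * (LINT y|contour_measure Poles. f x (of_real y + contour_shift (\<epsilon> $ j) Poles) * contour_weight (\<epsilon> $ j) Poles y)"
    proof -
      have fx: "f x = (\<lambda>w. F (\<chi> i. if i = j then w else z x i))" by (simp add: f_def fun_eq_iff)
      have "f x holomorphic_on UNIV" "strip_decay (f x)"
        unfolding fx by (rule holo slice_strip_decay)+
      from contour_step[OF this \<epsilon>[of j]] show ?thesis by simp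
    qed
    then show ?thesis unfolding inner_def by (simp only: distrib_left mult.left_commute)
  qed
  then have "(LINT x|?M. inner Raised x) = (LINT x|?M. inner Real_axis x + ?h * inner Poles x)" by simp
  also have "\<dots> = (LINT x|?M. inner Real_axis x) + ?h * (LINT x|?M. inner Poles x)"
    using integrable_inner by (subst Bochner_Integration.integral_add) auto
  finally have "(LINT x|?M. inner Raised x) = (LINT x|?M. inner Real_axis x) + ?h * (LINT x|?M. inner Poles x)" .
  moreover have "\<sigma>(j := Raised) = \<sigma>" using j by auto
  ultimately show ?thesis using multi[of Raised] multi[of Real_axis] multi[of Poles] by simp
qed

text \<open>
  Lowering the coordinates in \<open>S\<close> one after the other doubles the number of summands each time; \<open>v\<close>
  records the coordinates for which the sum over the poles was chosen.
\<close>
lemma multi_integral_expand: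
  fixes \<epsilon> :: "complex^'n"
  assumes \<epsilon>: "\<And>j. Re (\<epsilon> $ j) \<noteq> 0" and "\<And>j. j \<in> S \<Longrightarrow> \<sigma> j = Raised"
  shows "multi_integral \<epsilon> \<sigma> = (\<Sum>v\<in>Pow S. (\<Prod>j\<in>v. of_real ((1 + sgn (Re (\<epsilon> $ j))) / 2))
     * multi_integral \<epsilon> (\<lambda>j. if j \<in> v then Poles else if j \<in> S then Real_axis else \<sigma> j))"
  using finite[of S] assms(2)
proof (induction S rule: finite_induct)
  case empty
  then show ?case by simp
next
  case (insert k S)
  define h where "h j = complex_of_real ((1 + sgn (Re (\<epsilon> $ j))) / 2)" for j
  define \<rho> where "\<rho> S v = (\<lambda>j. if j \<in> v then Poles else if j \<in> S then Real_axis else \<sigma> j)" for S v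
  have step: "(\<Prod>j\<in>v. h j) * multi_integral \<epsilon> (\<rho> S v)
     = (\<Prod>j\<in>v. h j) * multi_integral \<epsilon> (\<rho> (insert k S) v) + (\<Prod>j\<in>insert k v. h j) * multi_integral \<epsilon> (\<rho> (insert k S) (insert k v))"
    if "v \<in> Pow S" for v
  proof -
    have kv: "k \<notin> v" "finite v" using that insert by auto
    then have "\<rho> S v k = Raised" using insert by (simp add: \<rho>_def)
    from multi_integral_step[where \<sigma>="\<rho> S v", OF \<epsilon> this]
    have "multi_integral \<epsilon> (\<rho> S v) = multi_integral \<epsilon> ((\<rho> S v)(k := Real_axis)) + h k * multi_integral \<epsilon> ((\<rho> S v)(k := Poles))"
      by (simp add: h_def)
    moreover have "(\<rho> S v)(k := Real_axis) = \<rho> (insert k S) v" "(\<rho> S v)(k := Poles) = \<rho> (insert k S) (insert k v)"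
      using kv by (auto simp: \<rho>_def)
    ultimately show ?thesis using kv by (simp add: algebra_simps)
  qed
  have "multi_integral \<epsilon> \<sigma> = (\<Sum>v\<in>Pow S. (\<Prod>j\<in>v. h j) * multi_integral \<epsilon> (\<rho> S v))"
    unfolding h_def \<rho>_def by (rule insert.IH) (use insert in auto)
  also have "\<dots> = (\<Sum>v\<in>Pow S. (\<Prod>j\<in>v. h j) * multi_integral \<epsilon> (\<rho> (insert k S) v))
     + (\<Sum>v\<in>Pow S. (\<Prod>j\<in>insert k v. h j) * multi_integral \<epsilon> (\<rho> (insert k S) (insert k v)))"
    by (simp only: step sum.distrib cong: sum.cong)
  also have "(\<Sum>v\<in>Pow S. (\<Prod>j\<in>insert k v. h j) * multi_integral \<epsilon> (\<rho> (insert k S) (insert k v)))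
     = (\<Sum>v\<in>insert k ` Pow S. (\<Prod>j\<in>v. h j) * multi_integral \<epsilon> (\<rho> (insert k S) v))"
  proof (subst sum.reindex)
    show "inj_on (insert k) (Pow S)"
      using insert(2) by (intro inj_onI) (metis PowD insert_ident subsetD)
  qed simp
  also have "(\<Sum>v\<in>Pow S. (\<Prod>j\<in>v. h j) * multi_integral \<epsilon> (\<rho> (insert k S) v)) + \<dots>
     = (\<Sum>v\<in>Pow (insert k S). (\<Prod>j\<in>v. h j) * multi_integral \<epsilon> (\<rho> (insert k S) v))"
    unfolding Pow_insert using insert by (subst sum.union_disjoint) auto
  finally show ?case unfolding h_def \<rho>_def .
qed

end

section \<open>The partial theta function as an integral over raised lines\<close>

definition half_naturals :: "real set" where
  "half_naturals = (\<lambda>l::nat. real l + 1/2) ` UNIV"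

lemma countable_half_naturals [simp]: "countable half_naturals"
  by (simp add: half_naturals_def)

lemma kern_geometric_integral:
  assumes "Im z > 0"
  shows "integrable (count_space half_naturals) (\<lambda>k. exp (2 * of_real pi * \<i> * of_real k * z))" (is "integrable _ ?f")
    and "(LINT k|count_space half_naturals. exp (2 * of_real pi * \<i> * of_real k * z)) = kern z"
proof -
  let ?h = "\<lambda>l::nat. real l + 1/2"
  have inj: "inj ?h" by (auto intro!: injI)
  have eq: "?f (?h l) = exp (2 * of_real pi * \<i> * (of_nat l + 1/2) * z)" for l by simp
  have "norm (?f (?h l)) = exp (- pi * Im z) * exp (- (2 * pi * Im z)) ^ l" for l
    by (simp add: algebra_simps flip: exp_of_nat_mult exp_add)
  moreover have "summable (\<lambda>l. exp (- pi * Im z) * exp (- (2 * pi * Im z)) ^ l)"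
    using assms by (intro summable_mult summable_geometric) simp
  ultimately have int: "integrable (count_space UNIV) (\<lambda>l. ?f (?h l))"
    by (simp add: integrable_count_space_nat_iff)
  then show "integrable (count_space half_naturals) ?f"
    unfolding half_naturals_def by (subst integrable_count_space_image[OF inj]) (simp add: o_def)
  have "bij_betw ?h UNIV half_naturals"
    unfolding half_naturals_def using inj by (rule inj_on_imp_bij_betw)
  then have "(LINT k|count_space half_naturals. ?f k) = (LINT l|count_space UNIV. ?f (?h l))"
    by (rule integral_bij_count_space[symmetric])
  also have "\<dots> = kern z"
    using sums_integral_count_space_nat[OF int] kern_geometric[OF assms] unfolding eq by (rule sums_unique2)
  finally show "(LINT k|count_space half_naturals. ?f k) = kern z" .
qed

lemma half_orthant_bij:
  "bij_betw (\<lambda>k. \<chi> j. of_real (k j)) (\<Pi>\<^sub>E j\<in>(UNIV::'n::finite set). half_naturals) (half_orthant :: (complex^'n) set)"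
proof (rule bij_betwI')
  fix k assume k: "k \<in> (\<Pi>\<^sub>E j\<in>(UNIV::'n set). half_naturals)"
  have "\<exists>l::nat. complex_of_real (k j) = of_nat l + 1/2" for j
  proof -
    obtain l :: nat where "k j = real l + 1/2" using k by (force simp: half_naturals_def)
    then show ?thesis by (intro exI[of _ l]) simp
  qed
  then show "(\<chi> j. of_real (k j)) \<in> (half_orthant :: (complex^'n) set)" by (simp add: half_orthant_def)
next
  fix z :: "complex^'n" assume "z \<in> half_orthant"
  then obtain l :: "'n \<Rightarrow> nat" where l: "z $ j = of_nat (l j) + 1/2" for j
    unfolding half_orthant_def by (auto dest!: choice)
  then show "\<exists>k\<in>(\<Pi>\<^sub>E j\<in>(UNIV::'n set). half_naturals). z = (\<chi> j. of_real (k j))"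
    by (intro bexI[of _ "\<lambda>j. real (l j) + 1/2"]) (auto simp: vec_eq_iff half_naturals_def)
qed (auto simp: vec_eq_iff fun_eq_iff)

context tube_entire begin

text \<open>
  On the raised lines the modulus of each geometric term depends only on its index, and it is summable.
  So the total integrand is dominated by a summable sequence times an integrable function, and
  summation and integration may be exchanged.
\<close>
lemma multi_integral_Raised:
  fixes \<epsilon> :: "complex^'n"
  defines "s \<equiv> \<lambda>j. \<i> * of_real (raised (\<epsilon> $ j))"
  assumes \<epsilon>: "\<And>j. Re (\<epsilon> $ j) \<noteq> 0"
  shows "multi_integral \<epsilon> (\<lambda>_. Raised) =
    (LINT k|count_space (\<Pi>\<^sub>E j\<in>(UNIV::'n set). half_naturals).
      (LINT x|(\<Pi>\<^sub>M j\<in>(UNIV::'n set). lborel). F (\<chi> j. of_real (x j) + s j)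
          * (\<Prod>j\<in>UNIV. exp (2 * of_real pi * \<i> * of_real (k j) * (of_real (x j) + s j - \<i> * \<epsilon> $ j)))))"
proof -
  let ?N = "\<Pi>\<^sub>E j\<in>(UNIV::'n set). half_naturals"
  let ?L = "\<Pi>\<^sub>M j\<in>(UNIV::'n set). (lborel :: real measure)"
  define \<kappa> where "\<kappa> k j x = exp (2 * of_real pi * \<i> * of_real k * (of_real x + s j - \<i> * \<epsilon> $ j))" for k :: real and j :: 'n and x :: real
  \<comment> \<open>The height of the \<open>j\<close>-th line above its poles.\<close>
  define \<eta> where "\<eta> j = raised (\<epsilon> $ j) - Re (\<epsilon> $ j)" for j
  have \<eta>: "\<eta> j > 0" for j using \<epsilon>[of j] by (auto simp: \<eta>_def raised_def)
  have Im: "Im (of_real x + s j - \<i> * \<epsilon> $ j) = \<eta> j" for x j by (simp add: \<eta>_def s_def)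
  have norm\<kappa>: "norm (\<kappa> k j x) = exp (- (2 * pi * k * \<eta> j))" for k j x
    unfolding \<kappa>_def norm_exp_eq_Re using Im[of x j] by simp
  have [simp]: "\<kappa> k j \<in> borel_measurable borel" for k j unfolding \<kappa>_def[abs_def] by measurable
  have PiM_N: "(\<Pi>\<^sub>M j\<in>(UNIV::'n set). count_space half_naturals) = count_space ?N"
    by (rule PiM_count_space) auto
  have sf: "sigma_finite_measure (count_space half_naturals)"
    by (rule sigma_finite_measure_count_space_countable) simp
  interpret H: product_sigma_finite "\<lambda>_::'n. count_space half_naturals"
    by (intro product_sigma_finite.intro sf)
  have cN: "countable ?N" by (intro countable_PiE) auto
  interpret L: sigma_finite_measure ?L
    by (rule lborel_product.sigma_finite) simp
  interpret N: sigma_finite_measure "count_space ?N"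
    by (rule sigma_finite_measure_count_space_countable[OF cN])
  interpret P: pair_sigma_finite "count_space ?N" ?L ..
  have expand: "(\<Prod>j\<in>UNIV. kern (of_real (x j) + s j - \<i> * \<epsilon> $ j)) = (LINT k|count_space ?N. (\<Prod>j\<in>UNIV. \<kappa> (k j) j (x j)))" for x
  proof -
    have "(\<Prod>j\<in>UNIV. kern (of_real (x j) + s j - \<i> * \<epsilon> $ j)) = (\<Prod>j\<in>UNIV. (LINT k|count_space half_naturals. \<kappa> k j (x j)))"
      unfolding \<kappa>_def by (intro prod.cong refl kern_geometric_integral(2)[symmetric]) (simp only: Im \<eta>)
    also have "\<dots> = (LINT k|(\<Pi>\<^sub>M j\<in>(UNIV::'n set). count_space half_naturals). (\<Prod>j\<in>UNIV. \<kappa> (k j) j (x j)))"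
      unfolding \<kappa>_def
      by (rule H.product_integral_prod[symmetric], simp, rule kern_geometric_integral(1), simp only: Im \<eta>)
    finally show ?thesis unfolding PiM_N .
  qed
  define f where "f k x = F (\<chi> j. of_real (x j) + s j) * (\<Prod>j\<in>UNIV. \<kappa> (k j) j (x j))" for k x
  have Fint: "integrable ?L (f k)" for k
  proof -
    have "integrable (\<Pi>\<^sub>M j\<in>UNIV. contour_measure ((\<lambda>_. Raised) j)) (\<lambda>x. F (\<chi> j. of_real (x j) + s j) * (\<Prod>j\<in>UNIV. \<kappa> (k j) j (x j)))"
    proof (rule weighted_integrable)
      fix \<delta> :: real and j :: 'n assume "\<delta> > 0"
      then show "integrable (contour_measure Raised) (\<lambda>x. exp (- \<delta> * (Re (of_real x + s j))\<^sup>2) * norm (\<kappa> (k j) j x))"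
        unfolding norm\<kappa> using gaussian_integrable[of \<delta> "Re (s j)"] by simp
    qed simp
    then show ?thesis unfolding f_def by simp
  qed
  have normf: "norm (f k x) = norm (F (\<chi> j. of_real (x j) + s j)) * (\<Prod>j\<in>UNIV. exp (- (2 * pi * k j * \<eta> j)))" for k x
    unfolding f_def norm_mult prod_norm[symmetric] norm\<kappa> ..
  have "integrable (count_space ?N \<Otimes>\<^sub>M ?L) (case_prod f)"
  proof (rule P.Fubini_integrable)
    show "case_prod f \<in> borel_measurable (count_space ?N \<Otimes>\<^sub>M ?L)"
      by (rule measurable_pair_measure_countable1[OF cN]) (use Fint in auto)
    show "AE k in count_space ?N. integrable ?L (\<lambda>x. case_prod f (k, x))"
      using Fint by simp
    have "integrable (count_space half_naturals) (\<lambda>k. exp (- (2 * pi * k * \<eta> j)))" for j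
      using integrable_norm[OF kern_geometric_integral(1)[of "\<i> * of_real (\<eta> j)"]] \<eta>[of j] by (simp add: mult_ac)
    then have "integrable (count_space ?N) (\<lambda>k. \<Prod>j\<in>UNIV. exp (- (2 * pi * k j * \<eta> j)))"
      unfolding PiM_N[symmetric] by (intro H.product_integrable_prod) auto
    then show "integrable (count_space ?N) (\<lambda>k. LINT x|?L. norm (case_prod f (k, x)))"
      by (simp add: normf)
  qed
  then have "(LINT x|?L. (LINT k|count_space ?N. f k x)) = (LINT k|count_space ?N. (LINT x|?L. f k x))"
    by (rule P.Fubini_integral)
  moreover have "multi_integral \<epsilon> (\<lambda>_. Raised) = (LINT x|?L. (LINT k|count_space ?N. f k x))"
    unfolding multi_integral_def contour_integrand_def contour_point_def f_def integral_mult_right_zero expand[symmetric]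
    by (simp add: s_def)
  ultimately show ?thesis unfolding f_def \<kappa>_def by simp
qed

end

lemma gauss_tube_entire:
  fixes A :: "real^'n^'n"
  assumes "transpose A = A" "pos_def A" "Im \<tau> > 0"
  shows "tube_entire (gauss (matrix_inv A) u \<tau>)"
proof
  show "continuous_on UNIV (gauss (matrix_inv A) u \<tau>)"
    unfolding gauss_def[abs_def] bilin_def matrix_vector_mult_def by (simp, intro continuous_intros)
  show "(\<lambda>w. gauss (matrix_inv A) u \<tau> (\<chi> i. if i = j then w else z i)) holomorphic_on UNIV" for z j
  proof -
    have coord: "(\<lambda>w. if i = j then w else z i) holomorphic_on UNIV" for i by (cases "i = j") auto
    show ?thesis
      unfolding gauss_def bilin_def matrix_vector_mult_def by (simp, intro holomorphic_intros coord)
  qed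
  show "tube_decay (gauss (matrix_inv A) u \<tau>)" by (rule gauss_tube_decay[OF assms])
qed

text \<open>
  A geometric term only shifts the linear part of the exponent, so every term of the expanded
  integral is again a Gaussian integral with \<open>u\<close> replaced by \<open>u - k\<close>.
\<close>
lemma gauss_mult_exp:
  "gauss B u \<tau> z * (\<Prod>j\<in>UNIV. exp (2 * of_real pi * \<i> * k $ j * (z $ j - \<i> * \<epsilon> $ j)))
    = exp (2 * of_real pi * bilin k \<epsilon>) * gauss B (u - k) \<tau> z"
proof -
  have "(\<Sum>j\<in>UNIV. 2 * of_real pi * \<i> * k $ j * (z $ j - \<i> * \<epsilon> $ j))
     = 2 * of_real pi * \<i> * bilin k z + 2 * of_real pi * bilin k \<epsilon>"
    by (simp add: bilin_def sum_distrib_left sum.distrib[symmetric] algebra_simps)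
  then have "(\<Prod>j\<in>UNIV. exp (2 * of_real pi * \<i> * k $ j * (z $ j - \<i> * \<epsilon> $ j)))
     = exp (2 * of_real pi * \<i> * bilin k z + 2 * of_real pi * bilin k \<epsilon>)"
    by (simp flip: exp_sum)
  moreover have "bilin (u - k) z = bilin u z - bilin k z"
    by (simp add: bilin_def sum_subtractf algebra_simps)
  then have "of_real pi * \<i> * \<tau> * bilin z (cmat B *v z) - 2 * of_real pi * \<i> * bilin u z
        + (2 * of_real pi * \<i> * bilin k z + 2 * of_real pi * bilin k \<epsilon>)
      = 2 * of_real pi * bilin k \<epsilon> + (of_real pi * \<i> * \<tau> * bilin z (cmat B *v z) - 2 * of_real pi * \<i> * bilin (u - k) z)"
    by (simp only:) (simp add: algebra_simps)
  ultimately show ?thesis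
    by (simp only: gauss_def flip: exp_add)
qed

lemma bilin_quadratic_diff:
  fixes M :: "complex^'n^'n"
  assumes "transpose M = M"
  shows "bilin (u - k) (M *v (u - k)) = bilin u (M *v u) - 2 * bilin k (M *v u) + bilin k (M *v k)"
proof -
  have "bilin u (M *v k) = bilin k (M *v u)"
    using bilin_mult_left[of M u k] assms by (simp add: bilin_commute)
  moreover have "bilin (x - y) z = bilin x z - bilin y z" "bilin z (x - y) = bilin z x - bilin z y" for x y z :: "complex^'n"
    by (simp_all add: bilin_def sum_subtractf algebra_simps)
  ultimately show ?thesis
    by (simp add: matrix_vector_mult_diff_distrib)
qed

text \<open>
  In the exponent of the \<open>k\<close>-th Gaussian integral, \<open>- \<pi> i / \<tau>\<close> times the quadratic form at \<open>u - k\<close>, the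
  part without \<open>k\<close> cancels against the exponential in front; what is left is the \<open>k\<close>-th term of
  the partial theta function at \<open>u / \<tau>\<close> and \<open>- 1 / \<tau>\<close>.
\<close>
lemma partial_theta_eq_multi_integral:
  fixes A :: "real^'n^'n" and u \<epsilon> :: "complex^'n"
  assumes sym: "transpose A = A" and pos: "pos_def A" and \<tau>: "Im \<tau> > 0" and \<epsilon>: "\<And>j. Re (\<epsilon> $ j) \<noteq> 0"
  shows "partial_theta A \<epsilon> ((1 / \<tau>) *s u) (- 1 / \<tau>) =
    exp (of_real pi * \<i> / \<tau> * bilin u (cmat A *v u)) * (csqrt (- \<i> * \<tau>) ^ CARD('n) / csqrt (of_real (det A)))
     * tube_entire.multi_integral (gauss (matrix_inv A) u \<tau>) \<epsilon> (\<lambda>_. Raised)"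
proof -
  interpret tube_entire "gauss (matrix_inv A) u \<tau>" by (rule gauss_tube_entire[OF sym pos \<tau>])
  let ?s = "\<chi> j. \<i> * of_real (raised (\<epsilon> $ j))"
  let ?N = "\<Pi>\<^sub>E j\<in>(UNIV::'n set). half_naturals"
  let ?L = "\<Pi>\<^sub>M j\<in>(UNIV::'n set). (lborel :: real measure)"
  define c where "c = csqrt (of_real (det A)) / csqrt (- \<i> * \<tau>) ^ CARD('n)"
  have \<tau>0: "\<tau> \<noteq> 0" using \<tau> by auto
  obtain P :: "real^'n^'n" where P: "transpose P ** A ** P = mat 1" using pos_def_congruent_identity[OF sym pos] .
  have "det A \<noteq> 0" using congruent_identityD(3,4)[OF P] by simp
  then have c0: "c \<noteq> 0" using \<tau>0 by (simp add: c_def)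
  have inner: "(LINT x|?L. gauss (matrix_inv A) u \<tau> (\<chi> j. of_real (x j) + \<i> * of_real (raised (\<epsilon> $ j)))
      * (\<Prod>j\<in>UNIV. exp (2 * of_real pi * \<i> * of_real (k j) * (of_real (x j) + \<i> * of_real (raised (\<epsilon> $ j)) - \<i> * \<epsilon> $ j))))
    = exp (2 * of_real pi * bilin (\<chi> j. of_real (k j)) \<epsilon>)
      * (c * exp (- (of_real pi * \<i> / \<tau> * bilin (u - (\<chi> j. of_real (k j))) (cmat A *v (u - (\<chi> j. of_real (k j)))))))" for k
  proof -
    let ?k = "\<chi> j. of_real (k j)"
    have "(LINT x|?L. gauss (matrix_inv A) u \<tau> (\<chi> j. of_real (x j) + \<i> * of_real (raised (\<epsilon> $ j)))
      * (\<Prod>j\<in>UNIV. exp (2 * of_real pi * \<i> * of_real (k j) * (of_real (x j) + \<i> * of_real (raised (\<epsilon> $ j)) - \<i> * \<epsilon> $ j))))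
      = (LINT x|?L. exp (2 * of_real pi * bilin ?k \<epsilon>) * gauss (matrix_inv A) (u - ?k) \<tau> (cvec (vec_lambda x) + ?s))"
    proof (rule Bochner_Integration.integral_cong[OF refl])
      fix x
      have "cvec (vec_lambda x) + ?s = (\<chi> j. of_real (x j) + \<i> * of_real (raised (\<epsilon> $ j)))"
        by (simp add: vec_eq_iff cvec_def)
      then show "gauss (matrix_inv A) u \<tau> (\<chi> j. of_real (x j) + \<i> * of_real (raised (\<epsilon> $ j)))
      * (\<Prod>j\<in>UNIV. exp (2 * of_real pi * \<i> * of_real (k j) * (of_real (x j) + \<i> * of_real (raised (\<epsilon> $ j)) - \<i> * \<epsilon> $ j)))
       = exp (2 * of_real pi * bilin ?k \<epsilon>) * gauss (matrix_inv A) (u - ?k) \<tau> (cvec (vec_lambda x) + ?s)"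
        by (subst gauss_mult_exp[symmetric]) simp
    qed
    also have "\<dots> = exp (2 * of_real pi * bilin ?k \<epsilon>) * (LINT x|lborel. gauss (matrix_inv A) (u - ?k) \<tau> (cvec x + ?s))"
    proof -
      have "continuous_on UNIV (\<lambda>x::real^'n. gauss (matrix_inv A) (u - ?k) \<tau> (cvec x + ?s))"
        unfolding gauss_def[abs_def] bilin_def matrix_vector_mult_def cvec_def by (simp, intro continuous_intros)
      then show ?thesis
        by (subst integral_lborel_vec) (auto intro: borel_measurable_continuous_onI)
    qed
    also have "(LINT x|lborel. gauss (matrix_inv A) (u - ?k) \<tau> (cvec x + ?s))
      = c * exp (- (of_real pi * \<i> / \<tau> * bilin (u - ?k) (cmat A *v (u - ?k))))"
      unfolding c_def by (rule gauss_integral[OF sym pos \<tau>])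
    finally show ?thesis .
  qed
  have term_eq: "qpow (- 1 / \<tau>) (1/2 * bilin k (cmat A *v k))
        * exp (2 * of_real pi * \<i> * bilin k (cmat A *v ((1 / \<tau>) *s u)))
        * exp (2 * of_real pi * bilin k \<epsilon>)
     = exp (of_real pi * \<i> / \<tau> * bilin u (cmat A *v u)) / c
        * (exp (2 * of_real pi * bilin k \<epsilon>) * (c * exp (- (of_real pi * \<i> / \<tau> * bilin (u - k) (cmat A *v (u - k))))))" for k
  proof -
    have "bilin k (cmat A *v ((1 / \<tau>) *s u)) = bilin k (cmat A *v u) / \<tau>"
      by (simp add: bilin_def vector_scalar_commute sum_divide_distrib)
    moreover have "transpose (cmat A) = cmat A" using sym by (metis cmat_transpose)
    ultimately have "2 * of_real pi * \<i> * (- 1 / \<tau>) * (1/2 * bilin k (cmat A *v k))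
        + 2 * of_real pi * \<i> * bilin k (cmat A *v ((1 / \<tau>) *s u)) + 2 * of_real pi * bilin k \<epsilon>
      = of_real pi * \<i> / \<tau> * bilin u (cmat A *v u)
        + (2 * of_real pi * bilin k \<epsilon> + - (of_real pi * \<i> / \<tau> * bilin (u - k) (cmat A *v (u - k))))"
      using \<tau>0 by (simp only: bilin_quadratic_diff) (simp add: field_simps)
    then show ?thesis
      using c0 by (simp add: qpow_def flip: exp_add) (simp add: algebra_simps)
  qed
  have "partial_theta A \<epsilon> ((1 / \<tau>) *s u) (- 1 / \<tau>) = (LINT k|count_space half_orthant.
      exp (of_real pi * \<i> / \<tau> * bilin u (cmat A *v u)) / c
        * (exp (2 * of_real pi * bilin k \<epsilon>) * (c * exp (- (of_real pi * \<i> / \<tau> * bilin (u - k) (cmat A *v (u - k)))))))"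
    unfolding partial_theta_def term_eq infsum_eq_integral_count_space ..
  also have "\<dots> = exp (of_real pi * \<i> / \<tau> * bilin u (cmat A *v u)) / c * (LINT k|count_space half_orthant.
        (exp (2 * of_real pi * bilin k \<epsilon>) * (c * exp (- (of_real pi * \<i> / \<tau> * bilin (u - k) (cmat A *v (u - k)))))))"
    by (rule integral_mult_right_zero)
  also have "(LINT k|count_space half_orthant.
        (exp (2 * of_real pi * bilin k \<epsilon>) * (c * exp (- (of_real pi * \<i> / \<tau> * bilin (u - k) (cmat A *v (u - k)))))))
     = multi_integral \<epsilon> (\<lambda>_. Raised)"
    unfolding multi_integral_Raised[OF \<epsilon>] inner
    by (rule integral_bij_count_space[OF half_orthant_bij, symmetric])
  finally show ?thesis by (simp add: c_def)
qed

section \<open>The summand of a set of lattice coordinates\<close>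

lemma minus_one_powi: "(- 1) powi n = (if even n then 1 else - 1 :: complex)"
  by (cases "n \<ge> 0") (auto simp: power_int_def even_nat_iff)

lemma prod_cos_pi_Ints:
  assumes "finite v"
  shows "(\<Prod>j\<in>v. complex_of_real (cos (pi * of_int (l j)))) = (- 1) powi (\<Sum>j\<in>v. l j)"
  using assms by (induction v rule: finite_induct) (auto simp: power_int_add minus_one_powi)

lemma transpose_matrix_inv:
  fixes A :: "real^'n^'n"
  assumes "transpose A = A" "pos_def A"
  shows "transpose (matrix_inv A) = matrix_inv A"
proof -
  obtain P :: "real^'n^'n" where P: "transpose P ** A ** P = mat 1" using pos_def_congruent_identity[OF assms] .
  show ?thesis unfolding congruent_identityD(1)[OF P] by (simp add: matrix_transpose_mul)
qed

lemma Ints_functions_bij: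
  "bij_betw (\<lambda>l. \<lambda>j\<in>v. real_of_int (l j)) (\<Pi>\<^sub>E j\<in>v. (UNIV :: int set)) (\<Pi>\<^sub>E j\<in>v. \<int>)"
proof (rule bij_betw_byWitness[where f' = "\<lambda>y. \<lambda>j\<in>v. \<lfloor>y j\<rfloor>"])
  show "\<forall>l\<in>(\<Pi>\<^sub>E j\<in>v. (UNIV :: int set)). (\<lambda>j\<in>v. \<lfloor>(\<lambda>j\<in>v. real_of_int (l j)) j\<rfloor>) = l"
    by (auto simp: fun_eq_iff PiE_iff extensional_def)
  show "\<forall>y\<in>(\<Pi>\<^sub>E j\<in>v. \<int>). (\<lambda>j\<in>v. real_of_int ((\<lambda>j\<in>v. \<lfloor>y j\<rfloor>) j)) = y"
    by (auto simp: fun_eq_iff PiE_iff extensional_def)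
qed auto

lemma bilin_quadratic_add:
  fixes M :: "complex^'n^'n"
  assumes "transpose M = M"
  shows "bilin (x + y) (M *v (x + y)) = bilin x (M *v x) + 2 * bilin y (M *v x) + bilin y (M *v y)"
proof -
  have "bilin (- a) b = - bilin a b" "bilin a (- b) = - bilin a b" for a b :: "complex^'n"
    by (simp_all add: bilin_def sum_negf)
  moreover have "M *v (- y) = - (M *v y)" by (simp add: vec_eq_iff matrix_vector_mult_def sum_negf)
  ultimately show ?thesis
    using bilin_quadratic_diff[OF assms, of x "- y"] by simp
qed

text \<open>
  The point is split into its lattice part \<open>\<mu>\<close> on \<open>v\<close> and the rest \<open>w\<close>. The cross term of the quadratic form
  is linear in \<open>\<mu>\<close>; together with the part of \<open>(u, z)\<close> from \<open>v\<close> it makes up the argument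
  \<open>x \<tau> - u\<close> of the theta function.
\<close>
lemma gauss_eq_theta_term:
  fixes B :: "real^'n^'n" and u \<mu> w :: "complex^'n"
  assumes "transpose B = B"
  shows "gauss B u \<tau> (w + (\<chi> j. if j \<in> v then \<mu> $ j else 0)) =
    qpow \<tau> (1/2 * (\<Sum>a\<in>v. \<Sum>b\<in>v. \<mu> $ a * of_real (B $ a $ b) * \<mu> $ b))
     * exp (2 * of_real pi * \<i> * (\<Sum>j\<in>v. ((cmat B *v w) $ j * \<tau> - u $ j) * \<mu> $ j))
     * (qpow \<tau> (1/2 * bilin w (cmat B *v w)) * exp (- 2 * of_real pi * \<i> * bilin u w))"
proof -
  let ?\<mu> = "\<chi> j. if j \<in> v then \<mu> $ j else 0"
  have restrict: "(\<Sum>j\<in>UNIV. (if j \<in> v then g j else 0)) = (\<Sum>j\<in>v. g j)" for g :: "'n \<Rightarrow> complex"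
    by (simp add: sum.If_cases)
  have bil: "bilin ?\<mu> x = (\<Sum>j\<in>v. \<mu> $ j * x $ j)" "bilin x ?\<mu> = (\<Sum>j\<in>v. x $ j * \<mu> $ j)" for x
    unfolding bilin_def by (simp_all add: restrict if_distrib[of "\<lambda>a. a * _"] if_distrib[of "\<lambda>a. _ * a"] cong: if_cong)
  have "(cmat B *v ?\<mu>) $ a = (\<Sum>b\<in>v. of_real (B $ a $ b) * \<mu> $ b)" for a
    by (simp add: matrix_vector_mult_def cmat_def restrict if_distrib[of "\<lambda>a. _ * a"] cong: if_cong)
  then have quad: "bilin ?\<mu> (cmat B *v ?\<mu>) = (\<Sum>a\<in>v. \<Sum>b\<in>v. \<mu> $ a * of_real (B $ a $ b) * \<mu> $ b)"
    by (simp add: bil sum_distrib_left mult.assoc)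
  have lin: "(\<Sum>j\<in>v. ((cmat B *v w) $ j * \<tau> - u $ j) * \<mu> $ j) = \<tau> * bilin ?\<mu> (cmat B *v w) - bilin u ?\<mu>"
    by (simp add: bil sum_subtractf sum_distrib_left algebra_simps)
  have "transpose (cmat B) = cmat B" using assms by (metis cmat_transpose)
  note add = bilin_quadratic_add[OF this, of w ?\<mu>]
  have u: "bilin u (w + ?\<mu>) = bilin u w + bilin u ?\<mu>"
    unfolding bilin_def sum.distrib[symmetric] by (simp add: distrib_left)
  show ?thesis
    unfolding gauss_def add u quad[symmetric] lin qpow_def exp_add[symmetric]
    by (intro arg_cong[of _ _ exp]) (simp add: algebra_simps)
qed

text \<open>
  Fubini's theorem separates the coordinates outside \<open>v\<close>, which run over the real axis, from the
  lattice coordinates, whose sum is the theta series. Each coordinate outside \<open>v\<close> brings a factor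
  \<open>- 1 / (2 i)\<close> from the definition of \<open>kern\<close>.
\<close>
lemma multi_integral_subset:
  fixes A :: "real^'n^'n" and u \<epsilon> :: "complex^'n" and v :: "'n set"
  assumes sym: "transpose A = A" and pos: "pos_def A" and \<tau>: "Im \<tau> > 0" and \<epsilon>: "\<And>j. Re (\<epsilon> $ j) \<noteq> 0"
  shows "tube_entire.multi_integral (gauss (matrix_inv A) u \<tau>) \<epsilon> (\<lambda>j. if j \<in> v then Poles else Real_axis)
    = (- 1 / (2 * \<i>)) ^ (CARD('n) - card v) * I_sub A \<epsilon> u \<tau> v"
proof -
  interpret tube_entire "gauss (matrix_inv A) u \<tau>" by (rule gauss_tube_entire[OF sym pos \<tau>])
  let ?B = "matrix_inv A"
  let ?\<sigma> = "\<lambda>j. if j \<in> v then Poles else Real_axis"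
  let ?f = "contour_integrand \<epsilon> ?\<sigma>"
  let ?Z = "\<Pi>\<^sub>E j\<in>v. (UNIV :: int set)"
  let ?y = "\<lambda>l. \<lambda>j\<in>v. real_of_int (l j)"
  define K where "K = (- 1 / (2 * \<i>)) ^ (CARD('n) - card v)"
  define rest where "rest w = qpow \<tau> (1/2 * bilin (cvec (zero_on v w)) (cmat ?B *v cvec (zero_on v w)))
     * exp (- 2 * of_real pi * \<i> * bilin u (cvec (zero_on v w)))
     / (\<Prod>j\<in>- v. sin (of_real pi * (cvec (zero_on v w) $ j - \<i> * \<epsilon> $ j)))" for w
  define t where "t w l = (let m = (\<lambda>j. of_int (l j) + \<i> * \<epsilon> $ j) in
          (- 1) powi (\<Sum>j\<in>v. l j)
          * qpow \<tau> (1/2 * (\<Sum>a\<in>v. \<Sum>b\<in>v. m a * of_real (?B $ a $ b) * m b))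
          * exp (2 * of_real pi * \<i> * (\<Sum>j\<in>v. ((cmat ?B *v cvec (zero_on v w)) $ j * \<tau> - u $ j) * m j)))"
    for w and l :: "'n \<Rightarrow> int"
  have U: "- v \<union> v = UNIV" by auto
  have integrand_eq: "?f (merge (- v) v (w, ?y l)) = K * (t w l * rest w)" for w l
  proof -
    let ?x = "merge (- v) v (w, ?y l)"
    let ?\<mu> = "\<chi> j. of_int (l j) + \<i> * \<epsilon> $ j"
    have x: "?x j = (if j \<in> v then of_int (l j) else w j)" for j by (auto simp: merge_def)
    have "contour_point \<epsilon> ?\<sigma> ?x = cvec (zero_on v w) + (\<chi> j. if j \<in> v then ?\<mu> $ j else 0)"
      by (auto simp: contour_point_def vec_eq_iff x cvec_def zero_on_def)
    moreover have "(\<Prod>j\<in>UNIV. contour_weight (\<epsilon> $ j) (?\<sigma> j) (?x j))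
       = (- 1) powi (\<Sum>j\<in>v. l j) * (K / (\<Prod>j\<in>- v. sin (of_real pi * (cvec (zero_on v w) $ j - \<i> * \<epsilon> $ j))))"
    proof -
      have "(\<Prod>j\<in>UNIV. contour_weight (\<epsilon> $ j) (?\<sigma> j) (?x j))
        = (\<Prod>j\<in>v. contour_weight (\<epsilon> $ j) (?\<sigma> j) (?x j)) * (\<Prod>j\<in>- v. contour_weight (\<epsilon> $ j) (?\<sigma> j) (?x j))"
        by (subst prod.union_disjoint[symmetric]) (auto simp: Un_commute U)
      also have "(\<Prod>j\<in>v. contour_weight (\<epsilon> $ j) (?\<sigma> j) (?x j)) = (- 1) powi (\<Sum>j\<in>v. l j)"
        using prod_cos_pi_Ints[of v l] by (simp add: x)
      also have "(\<Prod>j\<in>- v. contour_weight (\<epsilon> $ j) (?\<sigma> j) (?x j))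
        = (\<Prod>j\<in>- v. (- 1 / (2 * \<i>)) / sin (of_real pi * (cvec (zero_on v w) $ j - \<i> * \<epsilon> $ j)))"
        unfolding divide_divide_eq_left kern_def[symmetric]
        by (intro prod.cong refl) (simp add: x cvec_def zero_on_def)
      also have "\<dots> = K / (\<Prod>j\<in>- v. sin (of_real pi * (cvec (zero_on v w) $ j - \<i> * \<epsilon> $ j)))"
        by (simp only: prod_dividef prod_constant K_def power_divide Compl_eq_Diff_UNIV card_Diff_subset[OF finite subset_UNIV])
      finally show ?thesis .
    qed
    ultimately show ?thesis
      unfolding contour_integrand_def t_def rest_def Let_def
      by (simp add: gauss_eq_theta_term[OF transpose_matrix_inv[OF sym pos]])
  qed
  have theta: "(LINT l|count_space ?Z. t w l) = theta v (\<lambda>a b. ?B $ a $ b) (\<lambda>j. \<epsilon> $ j)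
      (\<lambda>j. (cmat ?B *v cvec (zero_on v w)) $ j * \<tau> - u $ j) \<tau>" for w
    unfolding theta_def t_def infsum_eq_integral_count_space ..
  have lines: "(\<Pi>\<^sub>M j\<in>- v. contour_measure (?\<sigma> j)) = (\<Pi>\<^sub>M j\<in>- v. lborel)"
    by (intro PiM_cong) auto
  have "countable (\<int> :: real set)" unfolding Ints_def by simp
  then have lattice: "(\<Pi>\<^sub>M j\<in>v. contour_measure (?\<sigma> j)) = count_space (\<Pi>\<^sub>E j\<in>v. \<int>)"
    by (subst PiM_count_space[symmetric]) (auto intro!: PiM_cong)
  have "multi_integral \<epsilon> ?\<sigma> = (LINT x|(\<Pi>\<^sub>M j\<in>- v \<union> v. contour_measure (?\<sigma> j)). ?f x)"
    unfolding multi_integral_def U ..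
  also have "\<dots> = (LINT w|(\<Pi>\<^sub>M j\<in>- v. contour_measure (?\<sigma> j)). (LINT y|(\<Pi>\<^sub>M j\<in>v. contour_measure (?\<sigma> j)). ?f (merge (- v) v (w, y))))"
    using contour_integrand_integrable[OF \<epsilon>, of ?\<sigma>] by (intro contour_product.product_integral_fold) (auto simp: U)
  also have "\<dots> = (LINT w|(\<Pi>\<^sub>M j\<in>- v. lborel). (LINT y|count_space (\<Pi>\<^sub>E j\<in>v. \<int>). ?f (merge (- v) v (w, y))))"
    unfolding lines lattice ..
  also have "\<dots> = (LINT w|(\<Pi>\<^sub>M j\<in>- v. lborel). (LINT l|count_space ?Z. K * (t w l * rest w)))"
    unfolding integrand_eq[symmetric]
    by (intro Bochner_Integration.integral_cong refl integral_bij_count_space[OF Ints_functions_bij, symmetric])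
  also have "\<dots> = K * I_sub A \<epsilon> u \<tau> v"
    unfolding integral_mult_right_zero integral_mult_left_zero theta
    unfolding I_sub_def rest_def Let_def ..
  finally show ?thesis unfolding K_def .
qed

text \<open>
  The theta series over the empty set has a single term, equal to \<open>1\<close>: the empty set of lattice
  coordinates accounts for \<open>h_eps\<close>.
\<close>
lemma I_sub_empty:
  fixes A :: "real^'n^'n" and u \<epsilon> :: "complex^'n"
  shows "I_sub A \<epsilon> u \<tau> {} = (LINT w|(lborel :: (real^'n) measure).
        qpow \<tau> (1/2 * bilin (cvec w) (cmat (matrix_inv A) *v cvec w))
        * exp (- 2 * of_real pi * \<i> * bilin u (cvec w))
        / (\<Prod>j\<in>UNIV. sin (of_real pi * (of_real (w $ j) - \<i> * \<epsilon> $ j))))"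
proof -
  have cont: "continuous_on UNIV (\<lambda>w::real^'n. w $ j)" for j by (intro continuous_intros)
  have [measurable]: "(\<lambda>w::real^'n. w $ j) \<in> borel_measurable borel" for j
    by (rule borel_measurable_continuous_onI[OF cont])
  have "zero_on {} w = vec_lambda w" for w :: "'n \<Rightarrow> real" by (simp add: zero_on_def)
  moreover have "theta {} B' \<epsilon>' u' \<tau> = 1" for B' and \<epsilon>' u' :: "'n \<Rightarrow> complex"
    by (simp add: theta_def qpow_def)
  ultimately show ?thesis
    unfolding I_sub_def Let_def
    by (subst integral_lborel_vec)
      (simp_all add: qpow_def bilin_def matrix_vector_mult_def cmat_def cvec_def)
qed

theorem theorem7:
  fixes A :: "real^'n^'n" and u \<epsilon> :: "complex^'n" and \<tau> :: complex
  assumes "transpose A = A"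
    and "pos_def A"
    and "\<And>i j. A $ i $ j \<in> \<int>"
    and "Im \<tau> > 0"
    and "\<And>j. Re (\<epsilon> $ j) \<noteq> 0"
  shows "partial_theta A \<epsilon> ((1 / \<tau>) *s u) (- 1 / \<tau>) =
    (- 1) ^ CARD('n) * h_eps A \<epsilon> u \<tau>
    + prefactor A u \<tau> *
      (\<Sum>v\<in>{v :: 'n set. v \<noteq> {}}.
         (- 1) ^ (CARD('n) - card v) * \<i> ^ card v
         * (\<Prod>j\<in>v. of_real (1 + sgn (Re (\<epsilon> $ j))))
         * I_sub A \<epsilon> u \<tau> v)"
proof -
  interpret tube_entire "gauss (matrix_inv A) u \<tau>" by (rule gauss_tube_entire[OF assms(1,2,4)])
  define T where "T v = (- 1) ^ (CARD('n) - card v) * \<i> ^ card v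
         * (\<Prod>j\<in>v. of_real (1 + sgn (Re (\<epsilon> $ j)))) * I_sub A \<epsilon> u \<tau> v" for v :: "'n set"
  define G where "G = exp (of_real pi * \<i> / \<tau> * bilin u (cmat A *v u)) * (csqrt (- \<i> * \<tau>) ^ CARD('n) / csqrt (of_real (det A)))"
  have pre: "prefactor A u \<tau> = G * inverse ((2 * \<i>) ^ CARD('n))"
    by (simp add: prefactor_def G_def mult_ac)
  have "multi_integral \<epsilon> (\<lambda>_. Raised) = (\<Sum>v\<in>UNIV. (\<Prod>j\<in>v. of_real ((1 + sgn (Re (\<epsilon> $ j))) / 2))
     * multi_integral \<epsilon> (\<lambda>j. if j \<in> v then Poles else Real_axis))"
    using multi_integral_expand[OF assms(5), of UNIV "\<lambda>_. Raised"] by (simp cong: if_cong)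
  also have "\<dots> = (\<Sum>v\<in>UNIV. inverse ((2 * \<i>) ^ CARD('n)) * T v)"
  proof (intro sum.cong refl)
    fix v :: "'n set"
    have n: "CARD('n) = (CARD('n) - card v) + card v" by (simp add: card_mono)
    let ?m = "CARD('n) - card v" and ?I = "I_sub A \<epsilon> u \<tau> v"
    let ?R = "\<Prod>j\<in>v. complex_of_real (1 + sgn (Re (\<epsilon> $ j)))"
    \<comment> \<open>Of the factor \<open>(2 i)\<close> to the power \<open>- n\<close>, each coordinate outside \<open>v\<close> takes \<open>1 / (2 i)\<close> from its kernel;\<close>
    \<comment> \<open>each one inside has \<open>i / (2 i) = 1 / 2\<close>, which halves \<open>1 + sgn (Re \<epsilon>\<^sub>j)\<close>.\<close>
    have R: "(\<Prod>j\<in>v. complex_of_real ((1 + sgn (Re (\<epsilon> $ j))) / 2)) = ?R / 2 ^ card v"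
      by (simp add: prod_dividef)
    have "(2 * \<i>) ^ CARD('n) = (2 * \<i>) ^ ?m * (2 * \<i>) ^ card v"
      by (subst n) (rule power_add)
    then have "(- 1 / (2 * \<i>)) ^ ?m / 2 ^ card v = inverse ((2 * \<i>) ^ CARD('n)) * ((- 1) ^ ?m * \<i> ^ card v)"
      unfolding power_divide power_mult_distrib by (simp add: field_simps)
    moreover have "?R / 2 ^ card v * ((- 1 / (2 * \<i>)) ^ ?m * ?I) = (- 1 / (2 * \<i>)) ^ ?m / 2 ^ card v * (?R * ?I)"
      by (simp only: times_divide_eq_left times_divide_eq_right mult_ac)
    ultimately show "(\<Prod>j\<in>v. of_real ((1 + sgn (Re (\<epsilon> $ j))) / 2)) * multi_integral \<epsilon> (\<lambda>j. if j \<in> v then Poles else Real_axis)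
       = inverse ((2 * \<i>) ^ CARD('n)) * T v"
      unfolding multi_integral_subset[OF assms(1,2,4,5)] T_def R by (simp only: mult.assoc)
  qed
  also have "\<dots> = inverse ((2 * \<i>) ^ CARD('n)) * (T {} + (\<Sum>v\<in>{v. v \<noteq> {}}. T v))"
  proof -
    have "(\<Sum>v\<in>UNIV. T v) = T {} + (\<Sum>v\<in>UNIV - {{}}. T v)" by (rule sum.remove) auto
    also have "UNIV - {{}} = {v :: 'n set. v \<noteq> {}}" by auto
    finally show ?thesis by (simp only: flip: sum_distrib_left)
  qed
  finally have "partial_theta A \<epsilon> ((1 / \<tau>) *s u) (- 1 / \<tau>) = prefactor A u \<tau> * T {} + prefactor A u \<tau> * (\<Sum>v\<in>{v. v \<noteq> {}}. T v)"
    unfolding partial_theta_eq_multi_integral[OF assms(1,2,4,5)] pre G_def by (simp only: distrib_left mult.assoc)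
  also have "prefactor A u \<tau> * T {} = (- 1) ^ CARD('n) * h_eps A \<epsilon> u \<tau>"
    unfolding T_def I_sub_empty h_eps_def by simp
  finally show ?thesis unfolding T_def .
qed

end
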